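(* For any Mal'cev variety with operations of finitely many different arities, the category of finite algebras for that Mal'cev variety, with morphisms given by surjections, is a diamond category.
   Context: A Mal'cev variety is a variety in the sense of universal algebra (a set of abstract $n$-ary operations for different natural numbers $n$, together with a set of equations they satisfy) such that some composition of the operations is a ternary operation $T(x,y,z)$ satisfying $T(x,x,z)=z$ and $T(x,z,z)=x$. A finite algebra for it is a finite set $S$ with functions $S^n\to S$ for each abstract $n$-ary operation (for each $n$) satisfying the equations of the variety; morphisms of algebras are functions respecting all the operations, and here only the surjective ones are taken as morphisms of the category. Let $C$ be a small category. A quotient of an object $G$ is a pair $(F,\pi)$ of an object $F$ and an epimorphism $\pi:G\to F$; quotients $(F,\pi),(F',\pi')$ are isomorphic if there is an isomorphism $\rho:F\to F'$ with $\pi'=\rho\pi$. Isomorphism classes of quotients of $G$ form a poset, where $H\ge F$ if there is $h:H\to F$ compatible with the morphisms from $G$; joins $\vee$ and meets $\wedge$ of quotients of $G$ are taken in this poset. A lattice (poset in which any two elements have a join and a meet) is modular if $a\le b$ implies $a\vee(x\wedge b)=(a\vee x)\wedge b$ for all $x$. For $F$ a quotient of $G$, $[F,G]$ is the poset of isomorphism classes of quotients of $G$ that are $\ge F$. An object is minimal if it has only one quotient (itself). A set $\mathcal{S}$ of objects, stable under isomorphism (equivalently a set of isomorphism classes), is downward-closed if every quotient of an object of $\mathcal{S}$ is in $\mathcal{S}$; it is join-closed if whenever $H,F\in\mathcal{S}$ are quotients of some object $G$ and $H\vee F$ exists, $H\vee F\in\mathcal{S}$. A level is a set of isomorphism classes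 generated by a finite set $B$ of isomorphism classes, i.e. the smallest downward-closed join-closed set containing $B$ and every minimal object. An epimorphism $G\to F$ is simple if it is not an isomorphism and $[F,G]$ contains only $F$ and $G$. A diamond category is a small category $C$ (up to equivalence: one may restrict to a set of representatives of the objects) such that: (1) for each object $G$, the set of isomorphism classes of quotients of $G$ is a finite modular lattice; (2) each object has finite automorphism group; (3) for each level $\mathcal{L}$ and each $G\in\mathcal{L}$, there are finitely many elements of $\mathcal{L}$ with a simple epimorphism to $G$; (4) $C$ has at most countably many isomorphism classes of minimal objects. *)

theory Defs
  imports "HOL-Algebra.Lattice" "HOL-Library.Countable_Set"
begin

section \<open>Categories, quotients and levels\<close>

text \<open>
  Hom-sets of distinct pairs of objects may overlap, so composition takes its three objects as
  arguments: for \<open>h \<in> Hom C A B\<close> and \<open>g \<in> Hom C B D\<close> the composite \<open>g h\<close> is \<open>Comp C A B D g h\<close>.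
\<close>

record ('o, 'm) cat =
  Obj :: "'o set"
  Hom :: "'o \<Rightarrow> 'o \<Rightarrow> 'm set"
  Id :: "'o \<Rightarrow> 'm"
  Comp :: "'o \<Rightarrow> 'o \<Rightarrow> 'o \<Rightarrow> 'm \<Rightarrow> 'm \<Rightarrow> 'm"

locale category =
  fixes C :: "('o, 'm) cat"
  assumes Id_in_Hom: "A \<in> Obj C \<Longrightarrow> Id C A \<in> Hom C A A"
    and Comp_in_Hom:
      "\<lbrakk>A \<in> Obj C; B \<in> Obj C; D \<in> Obj C; h \<in> Hom C A B; g \<in> Hom C B D\<rbrakk>
        \<Longrightarrow> Comp C A B D g h \<in> Hom C A D"
    and Comp_Id_right:
      "\<lbrakk>A \<in> Obj C; B \<in> Obj C; h \<in> Hom C A B\<rbrakk> \<Longrightarrow> Comp C A A B h (Id C A) = h"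
    and Comp_Id_left:
      "\<lbrakk>A \<in> Obj C; B \<in> Obj C; h \<in> Hom C A B\<rbrakk> \<Longrightarrow> Comp C A B B (Id C B) h = h"
    and Comp_assoc:
      "\<lbrakk>A \<in> Obj C; B \<in> Obj C; D \<in> Obj C; E \<in> Obj C;
        h \<in> Hom C A B; g \<in> Hom C B D; k \<in> Hom C D E\<rbrakk>
        \<Longrightarrow> Comp C A B E (Comp C B D E k g) h = Comp C A D E k (Comp C A B D g h)"

definition is_iso :: "('o, 'm) cat \<Rightarrow> 'o \<Rightarrow> 'o \<Rightarrow> 'm \<Rightarrow> bool" where
  "is_iso C A B f \<longleftrightarrow> f \<in> Hom C A B \<and>
    (\<exists>g \<in> Hom C B A. Comp C A B A g f = Id C A \<and> Comp C B A B f g = Id C B)"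

definition is_epi :: "('o, 'm) cat \<Rightarrow> 'o \<Rightarrow> 'o \<Rightarrow> 'm \<Rightarrow> bool" where
  "is_epi C A B f \<longleftrightarrow> f \<in> Hom C A B \<and>
    (\<forall>X \<in> Obj C. \<forall>g \<in> Hom C B X. \<forall>h \<in> Hom C B X.
      Comp C A B X g f = Comp C A B X h f \<longrightarrow> g = h)"

definition isomorphic :: "('o, 'm) cat \<Rightarrow> 'o \<Rightarrow> 'o \<Rightarrow> bool" where
  "isomorphic C A B \<longleftrightarrow> (\<exists>f. is_iso C A B f)"

definition iso_class :: "('o, 'm) cat \<Rightarrow> 'o \<Rightarrow> 'o set" where
  "iso_class C A = {B \<in> Obj C. isomorphic C A B}"

definition quotients :: "('o, 'm) cat \<Rightarrow> 'o \<Rightarrow> ('o \<times> 'm) set" where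
  "quotients C G = {(F, \<pi>). F \<in> Obj C \<and> is_epi C G F \<pi>}"

definition quotient_iso_rel :: "('o, 'm) cat \<Rightarrow> 'o \<Rightarrow> (('o \<times> 'm) \<times> ('o \<times> 'm)) set" where
  "quotient_iso_rel C G = {((F, \<pi>), (F', \<pi>')).
    (F, \<pi>) \<in> quotients C G \<and> (F', \<pi>') \<in> quotients C G \<and>
    (\<exists>\<rho>. is_iso C F F' \<rho> \<and> \<pi>' = Comp C G F F' \<rho> \<pi>)}"

definition quotient_class :: "('o, 'm) cat \<Rightarrow> 'o \<Rightarrow> 'o \<times> 'm \<Rightarrow> ('o \<times> 'm) set" where
  "quotient_class C G q = quotient_iso_rel C G `` {q}"

text \<open>The larger quotient is the one nearer to \<open>G\<close>: \<open>F \<sqsubseteq> H\<close> if \<open>G \<rightarrow> F\<close> factors through \<open>G \<rightarrow> H\<close>.\<close>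

definition quotient_poset :: "('o, 'm) cat \<Rightarrow> 'o \<Rightarrow> ('o \<times> 'm) set gorder" where
  "quotient_poset C G =
    \<lparr> carrier = quotients C G // quotient_iso_rel C G,
      eq = (=),
      le = (\<lambda>X Y. \<exists>(F, \<pi>) \<in> X. \<exists>(H, \<psi>) \<in> Y. \<exists>h \<in> Hom C H F. Comp C G H F h \<psi> = \<pi>) \<rparr>"

locale modular_lattice = lattice +
  assumes modular:
    "\<lbrakk>a \<in> carrier L; b \<in> carrier L; x \<in> carrier L; a \<sqsubseteq> b\<rbrakk>
      \<Longrightarrow> a \<squnion> (x \<sqinter> b) = (a \<squnion> x) \<sqinter> b"

definition quotient_interval :: "('o, 'm) cat \<Rightarrow> 'o \<Rightarrow> 'o \<times> 'm \<Rightarrow> ('o \<times> 'm) set set" where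
  "quotient_interval C G q =
    {X \<in> carrier (quotient_poset C G). quotient_class C G q \<sqsubseteq>\<^bsub>quotient_poset C G\<^esub> X}"

definition is_simple_epi :: "('o, 'm) cat \<Rightarrow> 'o \<Rightarrow> 'o \<Rightarrow> 'm \<Rightarrow> bool" where
  "is_simple_epi C G F \<pi> \<longleftrightarrow> is_epi C G F \<pi> \<and> \<not> is_iso C G F \<pi> \<and>
    quotient_interval C G (F, \<pi>) = {quotient_class C G (F, \<pi>), quotient_class C G (G, Id C G)}"

definition is_minimal :: "('o, 'm) cat \<Rightarrow> 'o \<Rightarrow> bool" where
  "is_minimal C G \<longleftrightarrow> G \<in> Obj C \<and>
    carrier (quotient_poset C G) = {quotient_class C G (G, Id C G)}"

definition iso_closed :: "('o, 'm) cat \<Rightarrow> 'o set \<Rightarrow> bool" where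
  "iso_closed C S \<longleftrightarrow> S \<subseteq> Obj C \<and> (\<forall>A \<in> S. iso_class C A \<subseteq> S)"

definition downward_closed :: "('o, 'm) cat \<Rightarrow> 'o set \<Rightarrow> bool" where
  "downward_closed C S \<longleftrightarrow> (\<forall>G \<in> S. \<forall>(F, \<pi>) \<in> quotients C G. F \<in> S)"

definition join_closed :: "('o, 'm) cat \<Rightarrow> 'o set \<Rightarrow> bool" where
  "join_closed C S \<longleftrightarrow> (\<forall>G \<in> Obj C.
    \<forall>(H, \<psi>) \<in> quotients C G. \<forall>(F, \<pi>) \<in> quotients C G. \<forall>(J, \<theta>) \<in> quotients C G.
      H \<in> S \<longrightarrow> F \<in> S \<longrightarrow>
      is_lub (quotient_poset C G) (quotient_class C G (J, \<theta>))
        {quotient_class C G (H, \<psi>), quotient_class C G (F, \<pi>)} \<longrightarrow>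
      J \<in> S)"

definition generated_level :: "('o, 'm) cat \<Rightarrow> 'o set \<Rightarrow> 'o set" where
  "generated_level C B = \<Inter> {S. iso_closed C S \<and> downward_closed C S \<and> join_closed C S \<and>
     B \<subseteq> S \<and> {G. is_minimal C G} \<subseteq> S}"

definition is_level :: "('o, 'm) cat \<Rightarrow> 'o set \<Rightarrow> bool" where
  "is_level C \<L> \<longleftrightarrow> (\<exists>B. finite B \<and> B \<subseteq> Obj C \<and> \<L> = generated_level C B)"

locale diamond_category = category C for C :: "('o, 'm) cat" +
  assumes quotients_modular:
      "G \<in> Obj C \<Longrightarrow> modular_lattice (quotient_poset C G)"
    and quotients_finite:
      "G \<in> Obj C \<Longrightarrow> finite (carrier (quotient_poset C G))"
    and finite_automorphisms:
      "G \<in> Obj C \<Longrightarrow> finite {f. is_iso C G G f}"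
    and finite_simple_epis:
      "\<lbrakk>is_level C \<L>; G \<in> \<L>\<rbrakk> \<Longrightarrow> finite (iso_class C ` {H \<in> \<L>. \<exists>\<pi>. is_simple_epi C H G \<pi>})"
    and countable_minimal:
      "countable (iso_class C ` {G. is_minimal C G})"

section \<open>Varieties and their algebras\<close>

datatype ('f, 'v) trm = Var 'v | Op 'f "('f, 'v) trm list"

primrec eval :: "('f \<Rightarrow> 'a list \<Rightarrow> 'a) \<Rightarrow> ('v \<Rightarrow> 'a) \<Rightarrow> ('f, 'v) trm \<Rightarrow> 'a" where
  "eval I v (Var x) = v x"
| "eval I v (Op f ts) = I f (map (eval I v) ts)"

abbreviation subst :: "('v \<Rightarrow> ('f, 'w) trm) \<Rightarrow> ('f, 'v) trm \<Rightarrow> ('f, 'w) trm" where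
  "subst \<equiv> eval Op"

primrec vars_trm :: "('f, 'v) trm \<Rightarrow> 'v set" where
  "vars_trm (Var x) = {x}"
| "vars_trm (Op f ts) = \<Union> (set (map vars_trm ts))"

text \<open>
  A variety is given by its operation symbols, their arities and its defining equations.
  Finitary equations need only countably many variables.
\<close>

record 'f presentation =
  symbols :: "'f set"
  arity :: "'f \<Rightarrow> nat"
  equations :: "(('f, nat) trm \<times> ('f, nat) trm) set"

inductive wf_trm :: "'f presentation \<Rightarrow> ('f, 'v) trm \<Rightarrow> bool" for V where
  wf_Var: "wf_trm V (Var x)"
| wf_Op: "\<lbrakk>f \<in> symbols V; length ts = arity V f; \<And>t. t \<in> set ts \<Longrightarrow> wf_trm V t\<rbrakk>
    \<Longrightarrow> wf_trm V (Op f ts)"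

definition is_variety :: "'f presentation \<Rightarrow> bool" where
  "is_variety V \<longleftrightarrow> (\<forall>(s, t) \<in> equations V. wf_trm V s \<and> wf_trm V t)"

text \<open>
  The identities satisfied by the operations of the variety are the consequences of its equations
  in equational logic.  This does not refer to a universe of algebras; the lemma
  \<open>satisfies_iff_holds_in_algebras\<close> below shows that it agrees with validity in all algebras.
\<close>

inductive satisfies :: "'f presentation \<Rightarrow> ('f, nat) trm \<Rightarrow> ('f, nat) trm \<Rightarrow> bool" for V where
  sat_refl: "wf_trm V t \<Longrightarrow> satisfies V t t"
| sat_sym: "satisfies V s t \<Longrightarrow> satisfies V t s"
| sat_trans: "\<lbrakk>satisfies V s t; satisfies V t u\<rbrakk> \<Longrightarrow> satisfies V s u"
| sat_cong: "\<lbrakk>f \<in> symbols V; length ss = arity V f; list_all2 (satisfies V) ss ts\<rbrakk>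
    \<Longrightarrow> satisfies V (Op f ss) (Op f ts)"
| sat_eqn: "\<lbrakk>(s, t) \<in> equations V; \<And>x. wf_trm V (\<sigma> x)\<rbrakk>
    \<Longrightarrow> satisfies V (subst \<sigma> s) (subst \<sigma> t)"

definition apply_ternary ::
  "('f, nat) trm \<Rightarrow> ('f, nat) trm \<Rightarrow> ('f, nat) trm \<Rightarrow> ('f, nat) trm \<Rightarrow> ('f, nat) trm" where
  "apply_ternary T x y z = subst (\<lambda>i. if i = 0 then x else if i = 1 then y else z) T"

definition malcev_variety :: "'f presentation \<Rightarrow> bool" where
  "malcev_variety V \<longleftrightarrow> is_variety V \<and>
    (\<exists>T. wf_trm V T \<and> vars_trm T \<subseteq> {0, 1, 2} \<and>
      (let x = Var 0; z = Var 1 in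
        satisfies V (apply_ternary T x x z) z \<and> satisfies V (apply_ternary T x z z) x))"

record ('a, 'f) alg = "'a partial_object" +
  oper :: "'f \<Rightarrow> 'a list \<Rightarrow> 'a"

definition holds_in :: "('a, 'f) alg \<Rightarrow> ('f, nat) trm \<Rightarrow> ('f, nat) trm \<Rightarrow> bool" where
  "holds_in A s t \<longleftrightarrow>
    (\<forall>v. range v \<subseteq> carrier A \<longrightarrow> eval (oper A) v s = eval (oper A) v t)"

text \<open>
  The operations are functions on tuples from the carrier; \<open>oper A\<close> is pinned to \<open>undefined\<close>
  elsewhere.  The empty algebra is allowed (it exists iff there are no nullary symbols).
\<close>

definition is_algebra :: "'f presentation \<Rightarrow> ('a, 'f) alg \<Rightarrow> bool" where
  "is_algebra V A \<longleftrightarrow>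
    (\<forall>f xs. if f \<in> symbols V \<and> length xs = arity V f \<and> set xs \<subseteq> carrier A
            then oper A f xs \<in> carrier A else oper A f xs = undefined) \<and>
    (\<forall>(s, t) \<in> equations V. holds_in A s t)"

definition surj_homs :: "'f presentation \<Rightarrow> ('a, 'f) alg \<Rightarrow> ('a, 'f) alg \<Rightarrow> ('a \<Rightarrow> 'a) set" where
  "surj_homs V A B = {h \<in> extensional (carrier A). h ` carrier A = carrier B \<and>
    (\<forall>f \<in> symbols V. \<forall>xs. length xs = arity V f \<and> set xs \<subseteq> carrier A \<longrightarrow>
      h (oper A f xs) = oper B f (map h xs))}"

text \<open>
  The underlying sets are the finite subsets of the type \<open>'a\<close>.  If \<open>'a\<close> is infinite, every finite
  algebra is isomorphic to one of these, so this is a small category equivalent to that of all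
  finite algebras.
\<close>

definition finite_algebra_category :: "'f presentation \<Rightarrow> (('a, 'f) alg, 'a \<Rightarrow> 'a) cat" where
  "finite_algebra_category V =
    \<lparr> Obj = {A. is_algebra V A \<and> finite (carrier A)},
      Hom = surj_homs V,
      Id = (\<lambda>A. \<lambda>x \<in> carrier A. x),
      Comp = (\<lambda>A B D g h. compose (carrier A) g h) \<rparr>"

section \<open>Soundness and completeness of equational logic\<close>

lemma wf_trm_Op_iff:
  "wf_trm V (Op f ts) \<longleftrightarrow>
    f \<in> symbols V \<and> length ts = arity V f \<and> (\<forall>t \<in> set ts. wf_trm V t)"
  by (auto intro: wf_Op elim: wf_trm.cases)

lemma wf_subst:
  assumes "wf_trm V t" "\<And>x. wf_trm V (\<sigma> x)"
  shows "wf_trm V (subst \<sigma> t)"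
  using assms(1) by induction (auto simp: assms(2) wf_trm_Op_iff)

lemma satisfies_wf:
  assumes "is_variety V" "satisfies V s t"
  shows "wf_trm V s \<and> wf_trm V t"
  using assms(2)
proof induction
  case (sat_cong f ss ts)
  then show ?case
    by (auto simp: wf_trm_Op_iff list_all2_conv_all_nth in_set_conv_nth)
next
  case (sat_eqn s t \<sigma>)
  then show ?case using assms(1) by (auto simp: is_variety_def intro: wf_subst)
qed auto

lemma eval_closed:
  assumes "is_algebra V A" "range v \<subseteq> carrier A" "wf_trm V t"
  shows "eval (oper A) v t \<in> carrier A"
  using assms(3)
proof induction
  case (wf_Op f ts)
  then have "set (map (eval (oper A) v) ts) \<subseteq> carrier A" by auto
  moreover have "length (map (eval (oper A) v) ts) = arity V f" using wf_Op by simp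
  ultimately show ?case using assms(1) wf_Op(1) unfolding is_algebra_def eval.simps by metis
qed (use assms(2) in auto)

lemma eval_subst: "eval I v (subst \<sigma> t) = eval I (\<lambda>x. eval I v (\<sigma> x)) t"
proof (induction t)
  case (Op f ts)
  then show ?case by (simp add: comp_def cong: map_cong)
qed auto

lemma satisfies_sound:
  assumes "is_variety V" "is_algebra V A" "satisfies V s t"
  shows "holds_in A s t"
  using assms(3)
proof induction
  case (sat_cong f ss ts)
  then have "map (eval (oper A) v) ss = map (eval (oper A) v) ts" if "range v \<subseteq> carrier A" for v
    using that by (auto simp: list_all2_conv_all_nth holds_in_def intro!: nth_equalityI)
  then show ?case by (simp add: holds_in_def del: map_eq_conv)
next
  case (sat_eqn s t \<sigma>)
  show ?case unfolding holds_in_def eval_subst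
  proof (intro allI impI)
    fix v :: "nat \<Rightarrow> 'b" assume v: "range v \<subseteq> carrier A"
    have "holds_in A s t" using assms(2) sat_eqn(1) by (auto simp: is_algebra_def)
    moreover have "range (\<lambda>x. eval (oper A) v (\<sigma> x)) \<subseteq> carrier A"
      using eval_closed[OF assms(2) v] sat_eqn(2) by auto
    ultimately show "eval (oper A) (\<lambda>x. eval (oper A) v (\<sigma> x)) s
        = eval (oper A) (\<lambda>x. eval (oper A) v (\<sigma> x)) t"
      by (simp add: holds_in_def)
  qed
qed (auto simp: holds_in_def)

definition free_class :: "'f presentation \<Rightarrow> ('f, nat) trm \<Rightarrow> ('f, nat) trm set" where
  "free_class V t = {s. satisfies V t s}"

definition free_alg :: "'f presentation \<Rightarrow> (('f, nat) trm set, 'f) alg" where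
  "free_alg V = \<lparr> carrier = free_class V ` {t. wf_trm V t},
     oper = (\<lambda>f Xs. if f \<in> symbols V \<and> length Xs = arity V f \<and>
                       set Xs \<subseteq> free_class V ` {t. wf_trm V t}
                    then free_class V (Op f (map (\<lambda>X. SOME t. t \<in> X) Xs)) else undefined) \<rparr>"

lemma free_class_eq_iff:
  assumes "wf_trm V s" "wf_trm V t"
  shows "free_class V s = free_class V t \<longleftrightarrow> satisfies V s t"
  using assms unfolding free_class_def by (blast intro: sat_refl sat_sym sat_trans)

lemma free_class_rep:
  assumes "wf_trm V t"
  shows "satisfies V t (SOME s. s \<in> free_class V t)"
proof -
  have "t \<in> free_class V t" using assms by (simp add: free_class_def sat_refl)
  then have "(SOME s. s \<in> free_class V t) \<in> free_class V t" by (rule someI)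
  then show ?thesis by (simp add: free_class_def)
qed

lemma eval_free:
  assumes V: "is_variety V" and t: "wf_trm V t" and \<sigma>: "\<And>x. wf_trm V (\<sigma> x)"
  shows "eval (oper (free_alg V)) (\<lambda>x. free_class V (\<sigma> x)) t = free_class V (subst \<sigma> t)"
  using t
proof induction
  case (wf_Op f ts)
  let ?r = "\<lambda>t. SOME s. s \<in> free_class V (subst \<sigma> t)"
  have wf: "wf_trm V (subst \<sigma> t)" if "t \<in> set ts" for t
    using wf_subst wf_Op(3) \<sigma> that by blast
  have map_eq: "map (eval (oper (free_alg V)) (\<lambda>x. free_class V (\<sigma> x))) ts
      = map (\<lambda>t. free_class V (subst \<sigma> t)) ts"
    using wf_Op by simp
  have in_carrier: "set (map (\<lambda>t. free_class V (subst \<sigma> t)) ts) \<subseteq> free_class V ` {t. wf_trm V t}"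
    using wf by auto
  have "satisfies V (Op f (map (subst \<sigma>) ts)) (Op f (map ?r ts))"
    by (rule sat_cong) (use wf_Op(1,2) wf in
        \<open>auto simp: list_all2_conv_all_nth intro!: free_class_rep\<close>)
  then have "free_class V (Op f (map ?r ts)) = free_class V (Op f (map (subst \<sigma>) ts))"
    using free_class_eq_iff satisfies_wf[OF V] by blast
  then show ?case
    unfolding eval.simps map_eq using wf_Op(1,2) in_carrier by (simp add: free_alg_def comp_def)
qed auto

lemma free_alg_is_algebra:
  assumes V: "is_variety V"
  shows "is_algebra V (free_alg V)"
  unfolding is_algebra_def
proof (intro conjI allI)
  fix f and Xs :: "('a, nat) trm set list"
  show "if f \<in> symbols V \<and> length Xs = arity V f \<and> set Xs \<subseteq> carrier (free_alg V)
    then oper (free_alg V) f Xs \<in> carrier (free_alg V) else oper (free_alg V) f Xs = undefined"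
  proof -
    have "wf_trm V (Op f (map (\<lambda>X. SOME t. t \<in> X) Xs))"
      if f: "f \<in> symbols V" "length Xs = arity V f"
        and Xs: "set Xs \<subseteq> free_class V ` {t. wf_trm V t}"
    proof -
      have "wf_trm V (SOME t. t \<in> X)" if "X \<in> set Xs" for X
        using that Xs free_class_rep satisfies_wf[OF V] by blast
      then show ?thesis using f by (simp add: wf_trm_Op_iff)
    qed
    then show ?thesis by (simp add: free_alg_def)
  qed
next
  show "\<forall>(s, t) \<in> equations V. holds_in (free_alg V) s t"
  proof (clarify, unfold holds_in_def, intro allI impI)
    fix s t and v :: "nat \<Rightarrow> ('a, nat) trm set"
    assume st: "(s, t) \<in> equations V" and v: "range v \<subseteq> carrier (free_alg V)"
    have "\<forall>x. \<exists>u. wf_trm V u \<and> v x = free_class V u"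
      using v by (auto simp: free_alg_def)
    then obtain \<sigma> where \<sigma>: "\<And>x. wf_trm V (\<sigma> x)" "v = (\<lambda>x. free_class V (\<sigma> x))"
      by metis
    have wf: "wf_trm V s" "wf_trm V t" using V st by (auto simp: is_variety_def)
    have "satisfies V (subst \<sigma> s) (subst \<sigma> t)" using st \<sigma>(1) by (rule sat_eqn)
    then show "eval (oper (free_alg V)) v s = eval (oper (free_alg V)) v t"
      unfolding \<sigma>(2) eval_free[OF V wf(1) \<sigma>(1)] eval_free[OF V wf(2) \<sigma>(1)]
      using free_class_eq_iff satisfies_wf[OF V] by blast
  qed
qed

lemma satisfies_iff_holds_in_algebras:
  fixes V :: "'f presentation"
  assumes V: "is_variety V" and wf: "wf_trm V s" "wf_trm V t"
  shows "satisfies V s t \<longleftrightarrow>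
    (\<forall>A :: (('f, nat) trm set, 'f) alg. is_algebra V A \<longrightarrow> holds_in A s t)"
proof
  assume "\<forall>A :: (('f, nat) trm set, 'f) alg. is_algebra V A \<longrightarrow> holds_in A s t"
  then have "holds_in (free_alg V) s t" using free_alg_is_algebra[OF V] by blast
  moreover have "range (\<lambda>x. free_class V (Var x)) \<subseteq> carrier (free_alg V)"
    by (auto simp: free_alg_def wf_Var)
  ultimately have "free_class V (subst Var s) = free_class V (subst Var t)"
    unfolding holds_in_def
      eval_free[OF V wf(1) wf_Var, symmetric] eval_free[OF V wf(2) wf_Var, symmetric] by blast
  moreover have "subst Var u = u" for u :: "('f, nat) trm"
    by (induction u) (auto simp: map_idI)
  ultimately show "satisfies V s t" using free_class_eq_iff[OF wf] by simp
qed (use satisfies_sound[OF V] in blast)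

end

theory Submission
  imports Defs
begin

text \<open>
  Quotients of a finite algebra \<open>G\<close> are, in reversed order, the congruences of \<open>G\<close>.  A Mal'cev term
  makes any two congruences permute (\<open>congruences_permute\<close>): if \<open>x \<alpha> y \<beta> z\<close> then
  \<open>x = T(x,y,y) \<beta> T(x,y,z) \<alpha> T(y,y,z) = z\<close>.  Hence the join of two congruences is their composite, and
  the modular law becomes an elementary law for composition of relations.  Minimal objects have
  at most one element, since the relation identifying everything is a congruence.

  The substance is that a level contains finitely many algebras with a simple epimorphism to a given
  \<open>G\<close>.  Let the level be generated by \<open>B\<close>, and let \<open>N \<ge> 1\<close> bound the sizes of the members of \<open>B\<close>.  Two
  properties are shared by the members of \<open>B\<close> and the minimal objects, and pass to all of the level:

  \<^item> if \<open>\<gamma>\<close> covers \<open>\<eta>\<close> in the congruence lattice, then every class of \<open>\<gamma>\<close> splits into at most \<open>N\<close>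
    classes of \<open>\<eta>\<close>;
  \<^item> operation symbols of equal arity with the same interpretation in all members of \<open>B\<close> have the same
    interpretation.

  Both pass to quotients trivially.  A join of two quotients of \<open>G\<close> is the quotient by the intersection
  \<open>\<kappa> \<inter> \<kappa>'\<close> of their kernels.  The second property is clearly inherited by it.  For the first
  (\<open>cover_index_bounded_inter\<close>), modularity transposes any cover above \<open>\<kappa> \<inter> \<kappa>'\<close>, in one step up or one
  step down and one step up, to a cover above \<open>\<kappa>\<close> or above \<open>\<kappa>'\<close>; and because congruences permute, a
  transposition preserves the number of classes into which a class splits
  (\<open>class_index_transpose\<close>).  This counting argument treats abelian and nonabelian covers alike.

  Applied to the cover of the identity by the kernel of a simple epimorphism \<open>H \<rightarrow> G\<close>, the first property
  bounds the size of \<open>H\<close> by \<open>N\<close> times that of \<open>G\<close>.  By the second one, and as the arity takes finitely many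
  values, \<open>H\<close> has finitely many essentially different operations, even if \<open>V\<close> has infinitely many
  symbols.  So there are finitely many possibilities for \<open>H\<close> (\<open>finite_iso_classes\<close>).
\<close>

section \<open>Lattices of permuting equivalence relations\<close>

text \<open>
  Closure under composition forces the relations to permute and makes composites joins.  The congruences
  of an algebra in a Mal'cev variety form such a family.
\<close>

locale permuting_equivalences =
  fixes X :: "'a set" and D :: "'a rel set"
  assumes equivalence: "r \<in> D \<Longrightarrow> equiv X r"
    and inter_closed: "\<lbrakk>r \<in> D; s \<in> D\<rbrakk> \<Longrightarrow> r \<inter> s \<in> D"
    and comp_closed: "\<lbrakk>r \<in> D; s \<in> D\<rbrakk> \<Longrightarrow> r O s \<in> D"
begin

lemma D_refl: "\<lbrakk>r \<in> D; x \<in> X\<rbrakk> \<Longrightarrow> (x, x) \<in> r"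
  using equivalence[of r] unfolding equiv_def refl_on_def by blast

lemma D_sym: "\<lbrakk>r \<in> D; (x, y) \<in> r\<rbrakk> \<Longrightarrow> (y, x) \<in> r"
  using equivalence[of r] unfolding equiv_def by (blast dest: symD)

lemma D_trans: "\<lbrakk>r \<in> D; (x, y) \<in> r; (y, z) \<in> r\<rbrakk> \<Longrightarrow> (x, z) \<in> r"
  using equivalence[of r] unfolding equiv_def by (blast dest: transD)

lemma D_field: "\<lbrakk>r \<in> D; (x, y) \<in> r\<rbrakk> \<Longrightarrow> x \<in> X \<and> y \<in> X"
  using equivalence[of r] unfolding equiv_def by blast

lemma comp_upper1: "\<lbrakk>r \<in> D; s \<in> D\<rbrakk> \<Longrightarrow> r \<subseteq> r O s"
proof (rule subrelI)
  fix x y assume "r \<in> D" "s \<in> D" "(x, y) \<in> r"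
  then show "(x, y) \<in> r O s" using D_field[of r x y] D_refl[of s y] by blast
qed

lemma comp_upper2: "\<lbrakk>r \<in> D; s \<in> D\<rbrakk> \<Longrightarrow> s \<subseteq> r O s"
proof (rule subrelI)
  fix x y assume "r \<in> D" "s \<in> D" "(x, y) \<in> s"
  then show "(x, y) \<in> r O s" using D_field[of s x y] D_refl[of r x] by blast
qed

lemma comp_least:
  assumes "t \<in> D" "r \<subseteq> t" "s \<subseteq> t"
  shows "r O s \<subseteq> t"
proof clarify
  fix x y z assume "(x, y) \<in> r" "(y, z) \<in> s"
  then show "(x, z) \<in> t" using assms D_trans[of t x y z] by blast
qed

text \<open>
  Both composites are the least member of \<open>D\<close> containing \<open>r\<close> and \<open>s\<close>.
\<close>

lemma comp_commute:
  assumes "r \<in> D" "s \<in> D"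
  shows "r O s = s O r"
proof
  show "r O s \<subseteq> s O r"
    using assms by (intro comp_least comp_closed comp_upper1 comp_upper2)
  show "s O r \<subseteq> r O s"
    using assms by (intro comp_least comp_closed comp_upper1 comp_upper2)
qed

text \<open>
  In \<open>x r y s z\<close> with \<open>x t z\<close>, the outer two relations give \<open>y t z\<close>.  With joins equal to composites this
  is the modular law.
\<close>

lemma dedekind_law:
  assumes "r \<in> D" "t \<in> D" "r \<subseteq> t"
  shows "r O (s \<inter> t) = (r O s) \<inter> t"
proof
  show "r O (s \<inter> t) \<subseteq> (r O s) \<inter> t"
    using assms D_trans[OF assms(2)] by blast
  show "(r O s) \<inter> t \<subseteq> r O (s \<inter> t)"
  proof clarify
    fix x y z assume "(x, y) \<in> r" "(y, z) \<in> s" "(x, z) \<in> t"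
    moreover from this have "(y, z) \<in> t"
      using assms(3) D_sym[OF assms(2)] D_trans[OF assms(2)] by blast
    ultimately show "(x, z) \<in> r O (s \<inter> t)" by blast
  qed
qed

text \<open>
  The order is reversed, so joins in \<open>L\<close> are intersections and meets are composites.
\<close>

lemma modular_lattice_of_dual_embedding:
  fixes L :: "('b, 'c) gorder_scheme"
  assumes eq: "eq L = (=)"
    and inj: "inj_on K (carrier L)"
    and image: "K ` carrier L = D"
    and le: "\<And>x y. \<lbrakk>x \<in> carrier L; y \<in> carrier L\<rbrakk> \<Longrightarrow> x \<sqsubseteq>\<^bsub>L\<^esub> y \<longleftrightarrow> K y \<subseteq> K x"
  shows "modular_lattice L"
proof -
  have K: "K x \<in> D" if "x \<in> carrier L" for x
    using that image by blast
  have surj: "\<exists>x \<in> carrier L. K x = r" if "r \<in> D" for r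
    using that image by blast
  interpret partial_order L
    using inj le unfolding inj_on_def
    by unfold_locales (auto simp: eq)
  have Upper: "Upper L {x, y} = {u \<in> carrier L. K u \<subseteq> K x \<inter> K y}"
    and Lower: "Lower L {x, y} = {u \<in> carrier L. K x \<subseteq> K u \<and> K y \<subseteq> K u}"
    if "x \<in> carrier L" "y \<in> carrier L" for x y
    using that le by (auto simp: Upper_def Lower_def)
  have lub: "is_lub L z {x, y}"
    if "x \<in> carrier L" "y \<in> carrier L" "z \<in> carrier L" "K z = K x \<inter> K y" for x y z
    unfolding least_def Upper[OF that(1,2)] using that by (auto simp: le)
  have glb: "is_glb L z {x, y}"
    if xyz: "x \<in> carrier L" "y \<in> carrier L" "z \<in> carrier L" "K z = K x O K y" for x y z
    unfolding greatest_def Lower[OF that(1,2)]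
    using xyz comp_upper1[OF K K, of x y] comp_upper2[OF K K, of x y] comp_least[OF K]
    by (auto simp: le simp del: relcomp.simps)
  interpret lattice L
  proof
    fix x y assume xy: "x \<in> carrier L" "y \<in> carrier L"
    obtain z where "z \<in> carrier L" "K z = K x \<inter> K y"
      using surj[OF inter_closed[OF K K, OF xy]] by blast
    then show "\<exists>s. is_lub L s {x, y}"
      using lub[OF xy] by blast
    obtain z where "z \<in> carrier L" "K z = K x O K y"
      using surj[OF comp_closed[OF K K, OF xy]] by blast
    then show "\<exists>s. is_glb L s {x, y}"
      using glb[OF xy] by blast
  qed
  have K_join: "K (x \<squnion>\<^bsub>L\<^esub> y) = K x \<inter> K y" if xy: "x \<in> carrier L" "y \<in> carrier L" for x y
  proof -
    obtain z where z: "z \<in> carrier L" "K z = K x \<inter> K y"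
      using surj[OF inter_closed[OF K K, OF xy]] by blast
    have "x \<squnion>\<^bsub>L\<^esub> y = z"
      using lub[OF xy z] sup_of_two_least[OF xy] unfolding join_def by (rule least_unique[rotated])
    then show ?thesis using z by simp
  qed
  have K_meet: "K (x \<sqinter>\<^bsub>L\<^esub> y) = K x O K y" if xy: "x \<in> carrier L" "y \<in> carrier L" for x y
  proof -
    obtain z where z: "z \<in> carrier L" "K z = K x O K y"
      using surj[OF comp_closed[OF K K, OF xy]] by blast
    have "x \<sqinter>\<^bsub>L\<^esub> y = z"
      using glb[OF xy z] inf_of_two_greatest[OF xy] unfolding meet_def by (rule greatest_unique[rotated])
    then show ?thesis using z by simp
  qed
  show ?thesis
  proof
    fix a b x
    assume abx: "a \<in> carrier L" "b \<in> carrier L" "x \<in> carrier L" and "a \<sqsubseteq>\<^bsub>L\<^esub> b"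
    then have sub: "K b \<subseteq> K a" using le by blast
    have "K (a \<squnion>\<^bsub>L\<^esub> (x \<sqinter>\<^bsub>L\<^esub> b)) = (K b O K x) \<inter> K a"
      using abx by (simp add: K_join K_meet comp_commute[OF K K] Int_commute)
    also have "\<dots> = K b O (K x \<inter> K a)"
      using dedekind_law[OF K K sub] abx by simp
    also have "\<dots> = K ((a \<squnion>\<^bsub>L\<^esub> x) \<sqinter>\<^bsub>L\<^esub> b)"
      using abx K inter_closed
      by (simp add: K_join K_meet comp_commute[of "K a \<inter> K x"] Int_commute)
    finally show "a \<squnion>\<^bsub>L\<^esub> (x \<sqinter>\<^bsub>L\<^esub> b) = (a \<squnion>\<^bsub>L\<^esub> x) \<sqinter>\<^bsub>L\<^esub> b"
      using inj abx by (auto dest: inj_onD)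
  qed
qed

end

definition covers :: "'a rel set \<Rightarrow> 'a rel \<Rightarrow> 'a rel \<Rightarrow> bool" where
  "covers D \<eta> \<gamma> \<longleftrightarrow> \<eta> \<in> D \<and> \<gamma> \<in> D \<and> \<eta> \<subset> \<gamma> \<and>
    (\<forall>\<theta> \<in> D. \<eta> \<subseteq> \<theta> \<longrightarrow> \<theta> \<subseteq> \<gamma> \<longrightarrow> \<theta> = \<eta> \<or> \<theta> = \<gamma>)"

text \<open>
  The covers above \<open>\<kappa>\<close> are those in the congruence lattice of the quotient by \<open>\<kappa>\<close>.  Expressing the bound
  on that quotient inside the lattice of \<open>G\<close> allows two quotients of \<open>G\<close> to be compared.
\<close>

definition cover_index_bounded :: "'a set \<Rightarrow> 'a rel set \<Rightarrow> nat \<Rightarrow> 'a rel \<Rightarrow> bool" where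
  "cover_index_bounded X D N \<kappa> \<longleftrightarrow>
    (\<forall>\<eta> \<gamma>. covers D \<eta> \<gamma> \<longrightarrow> \<kappa> \<subseteq> \<eta> \<longrightarrow> (\<forall>x \<in> X. card ((\<gamma> `` {x}) // \<eta>) \<le> N))"

lemma cover_index_bounded_mono:
  "\<lbrakk>cover_index_bounded X D N \<kappa>; \<kappa> \<subseteq> \<kappa>'\<rbrakk> \<Longrightarrow> cover_index_bounded X D N \<kappa>'"
  unfolding cover_index_bounded_def by blast

context permuting_equivalences
begin

text \<open>
  In a modular lattice the intervals \<open>[\<alpha> \<inter> \<delta>, \<alpha>]\<close> and \<open>[\<delta>, \<alpha> O \<delta>]\<close> are isomorphic; this lemma and the
  next take from that isomorphism that covers correspond to covers.
\<close>

lemma cover_transpose_up: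
  assumes D: "\<alpha> \<in> D" "\<delta> \<in> D" and cov: "covers D (\<alpha> \<inter> \<delta>) \<alpha>"
  shows "covers D \<delta> (\<alpha> O \<delta>)"
proof -
  have "\<theta> = \<delta> \<or> \<theta> = \<alpha> O \<delta>" if \<theta>: "\<theta> \<in> D" "\<delta> \<subseteq> \<theta>" "\<theta> \<subseteq> \<alpha> O \<delta>" for \<theta>
  proof -
    have "\<theta> = (\<delta> O \<alpha>) \<inter> \<theta>" using \<theta> comp_commute[OF D] by blast
    also have "\<dots> = \<delta> O (\<alpha> \<inter> \<theta>)" using dedekind_law D \<theta> by metis
    finally have \<theta>_eq: "\<theta> = \<delta> O (\<alpha> \<inter> \<theta>)" .
    have "\<alpha> \<inter> \<theta> = \<alpha> \<inter> \<delta> \<or> \<alpha> \<inter> \<theta> = \<alpha>"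
      using cov inter_closed[OF D(1) \<theta>(1)] Int_mono[OF order_refl \<theta>(2), of \<alpha>]
      unfolding covers_def by simp
    moreover have "\<delta> O (\<alpha> \<inter> \<delta>) = \<delta>"
      using comp_least[of \<delta> \<delta> "\<alpha> \<inter> \<delta>"] comp_upper1[of \<delta> "\<alpha> \<inter> \<delta>"] D inter_closed
      by (simp add: subset_antisym)
    ultimately show ?thesis using \<theta>_eq comp_commute[OF D] by metis
  qed
  moreover have "\<delta> \<noteq> \<alpha> O \<delta>"
    using cov comp_upper1[OF D] unfolding covers_def by blast
  ultimately show ?thesis
    using D comp_closed[OF D] comp_upper2[OF D] unfolding covers_def by (simp add: psubset_eq)
qed

lemma cover_transpose_down:
  assumes D: "\<alpha> \<in> D" "\<delta> \<in> D" and cov: "covers D \<delta> (\<alpha> O \<delta>)"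
  shows "covers D (\<alpha> \<inter> \<delta>) \<alpha>"
proof -
  have "\<theta> = \<alpha> \<inter> \<delta> \<or> \<theta> = \<alpha>" if \<theta>: "\<theta> \<in> D" "\<alpha> \<inter> \<delta> \<subseteq> \<theta>" "\<theta> \<subseteq> \<alpha>" for \<theta>
  proof -
    have "\<theta> O \<delta> = \<delta> \<or> \<theta> O \<delta> = \<alpha> O \<delta>"
      using cov comp_closed[OF \<theta>(1) D(2)] comp_upper2[OF \<theta>(1) D(2)]
        relcomp_mono[OF \<theta>(3) order_refl, of \<delta>]
      unfolding covers_def by simp
    then show ?thesis
    proof
      assume "\<theta> O \<delta> = \<delta>"
      then show ?thesis using \<theta> comp_upper1[OF \<theta>(1) D(2)] by blast
    next
      assume "\<theta> O \<delta> = \<alpha> O \<delta>"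
      then have "\<alpha> = (\<theta> O \<delta>) \<inter> \<alpha>" using comp_upper1[OF D] by blast
      also have "\<dots> = \<theta> O (\<delta> \<inter> \<alpha>)" using dedekind_law D \<theta> by metis
      also have "\<dots> \<subseteq> \<theta>" using comp_least[of \<theta> \<theta>] \<theta> by blast
      finally show ?thesis using \<theta> by blast
    qed
  qed
  moreover have "\<alpha> \<inter> \<delta> \<noteq> \<alpha>"
    using cov comp_least[of \<delta> \<alpha> \<delta>] D unfolding covers_def by blast
  ultimately show ?thesis
    using D inter_closed[OF D] unfolding covers_def by (simp add: psubset_eq)
qed

text \<open>
  Every member of the class of \<open>x\<close> under \<open>\<alpha> O \<delta>\<close> is \<open>\<delta>\<close>-equivalent to one of the class of \<open>x\<close> under \<open>\<alpha>\<close>.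
  Thus the \<open>\<delta>\<close>-classes in the former are those of members of the latter, two of which have the same
  \<open>\<delta>\<close>-class iff they have the same class under \<open>\<alpha> \<inter> \<delta>\<close>.
\<close>

lemma class_index_transpose:
  assumes D: "\<alpha> \<in> D" "\<delta> \<in> D"
  shows "card (((\<alpha> O \<delta>) `` {x}) // \<delta>) = card ((\<alpha> `` {x}) // (\<alpha> \<inter> \<delta>))"
proof -
  have eq: "\<delta> `` {y} = \<delta> `` {z} \<longleftrightarrow> (y, z) \<in> \<delta>" if "y \<in> X" "z \<in> X" for y z
    using that eq_equiv_class_iff[OF equivalence[OF D(2)]] by blast
  have "((\<alpha> O \<delta>) `` {x}) // \<delta> = (\<lambda>y. \<delta> `` {y}) ` ((\<alpha> O \<delta>) `` {x})"
    by (auto simp: quotient_def)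
  also have "\<dots> = (\<lambda>y. \<delta> `` {y}) ` (\<alpha> `` {x})"
  proof
    show "(\<lambda>y. \<delta> `` {y}) ` ((\<alpha> O \<delta>) `` {x}) \<subseteq> (\<lambda>y. \<delta> `` {y}) ` (\<alpha> `` {x})"
    proof clarify
      fix y z assume "(x, y) \<in> \<alpha>" "(y, z) \<in> \<delta>"
      moreover from this have "\<delta> `` {z} = \<delta> `` {y}"
        using equiv_class_eq[OF equivalence[OF D(2)]] by blast
      ultimately show "\<delta> `` {z} \<in> (\<lambda>y. \<delta> `` {y}) ` (\<alpha> `` {x})" by blast
    qed
    show "(\<lambda>y. \<delta> `` {y}) ` (\<alpha> `` {x}) \<subseteq> (\<lambda>y. \<delta> `` {y}) ` ((\<alpha> O \<delta>) `` {x})"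
      using comp_upper1[OF D] by blast
  qed
  finally have upper: "((\<alpha> O \<delta>) `` {x}) // \<delta> = (\<lambda>y. \<delta> `` {y}) ` (\<alpha> `` {x})" .
  have lower: "(\<alpha> `` {x}) // (\<alpha> \<inter> \<delta>) = (\<lambda>y. (\<alpha> \<inter> \<delta>) `` {y}) ` (\<alpha> `` {x})"
    by (auto simp: quotient_def)
  have same: "\<delta> `` {y} = \<delta> `` {z} \<longleftrightarrow> (\<alpha> \<inter> \<delta>) `` {y} = (\<alpha> \<inter> \<delta>) `` {z}"
    if "y \<in> \<alpha> `` {x}" "z \<in> \<alpha> `` {x}" for y z
  proof -
    have yz: "(x, y) \<in> \<alpha>" "(x, z) \<in> \<alpha>" using that by auto
    then have "y \<in> X" "z \<in> X" using D_field[OF D(1)] by blast+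
    moreover have "(y, z) \<in> \<alpha>" by (rule D_trans[OF D(1) D_sym[OF D(1) yz(1)] yz(2)])
    ultimately show ?thesis
      using eq[of y z] eq_equiv_class_iff[OF equivalence[OF inter_closed[OF D]], of y z] by simp
  qed
  have "bij_betw (\<lambda>c. \<delta> `` c) ((\<alpha> `` {x}) // (\<alpha> \<inter> \<delta>)) (((\<alpha> O \<delta>) `` {x}) // \<delta>)"
  proof -
    have saturate: "\<delta> `` ((\<alpha> \<inter> \<delta>) `` {y}) = \<delta> `` {y}" if "y \<in> \<alpha> `` {x}" for y
    proof -
      have "y \<in> X" using that D_field[OF D(1)] by blast
      then have "y \<in> (\<alpha> \<inter> \<delta>) `` {y}" using D_refl D by simp
      then show ?thesis using D_trans[OF D(2)] by blast
    qed
    have "inj_on (\<lambda>c. \<delta> `` c) ((\<alpha> `` {x}) // (\<alpha> \<inter> \<delta>))"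
      unfolding lower inj_on_def using saturate same by auto
    moreover have "(\<lambda>c. \<delta> `` c) ` ((\<alpha> `` {x}) // (\<alpha> \<inter> \<delta>)) = ((\<alpha> O \<delta>) `` {x}) // \<delta>"
      unfolding lower upper image_image using saturate by (intro image_cong) auto
    ultimately show ?thesis unfolding bij_betw_def by blast
  qed
  then show ?thesis by (simp add: bij_betw_same_card)
qed

text \<open>
  If \<open>\<alpha> \<inter> \<kappa> \<subseteq> \<beta>\<close>, then by modularity \<open>\<beta> O \<kappa>\<close> meets \<open>\<alpha>\<close> in \<open>\<beta>\<close>, and so the cover of \<open>\<beta>\<close> by \<open>\<alpha>\<close>
  transposes up to a cover above \<open>\<kappa>\<close>.
\<close>

lemma class_index_le_via_transpose:
  assumes D: "\<alpha> \<in> D" "\<beta> \<in> D" "\<kappa> \<in> D" and cov: "covers D \<beta> \<alpha>" and sub: "\<alpha> \<inter> \<kappa> \<subseteq> \<beta>"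
    and bound: "cover_index_bounded X D N \<kappa>" and x: "x \<in> X"
  shows "card ((\<alpha> `` {x}) // \<beta>) \<le> N"
proof -
  define \<delta> where "\<delta> = \<beta> O \<kappa>"
  have \<delta>: "\<delta> \<in> D" "\<kappa> \<subseteq> \<delta>"
    unfolding \<delta>_def using D comp_closed comp_upper2 by auto
  have "\<beta> \<subseteq> \<alpha>" using cov unfolding covers_def by blast
  then have "\<alpha> \<inter> \<delta> = \<beta> O (\<kappa> \<inter> \<alpha>)"
    unfolding \<delta>_def using dedekind_law[OF D(2,1)] by blast
  also have "\<dots> = \<beta>"
    using comp_least[of \<beta> \<beta> "\<kappa> \<inter> \<alpha>"] comp_upper1[of \<beta> "\<kappa> \<inter> \<alpha>"] D sub inter_closed
    by (simp add: Int_commute subset_antisym)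
  finally have meet: "\<alpha> \<inter> \<delta> = \<beta>" .
  then have "covers D \<delta> (\<alpha> O \<delta>)"
    using cover_transpose_up D(1) \<delta>(1) cov by simp
  then have "card (((\<alpha> O \<delta>) `` {x}) // \<delta>) \<le> N"
    using bound \<delta>(2) x unfolding cover_index_bounded_def by blast
  then show ?thesis using class_index_transpose[OF D(1) \<delta>(1)] meet by simp
qed

text \<open>
  A cover \<open>\<gamma>\<close> of \<open>\<eta>\<close> with \<open>\<gamma> \<inter> \<kappa> \<subseteq> \<eta>\<close> transposes up to a cover above \<open>\<kappa>\<close>.  Otherwise \<open>\<gamma> = (\<gamma> \<inter> \<kappa>) O \<eta>\<close>,
  so the cover transposes down to one whose top \<open>\<alpha> = \<gamma> \<inter> \<kappa>\<close> lies below \<open>\<kappa>\<close>.  Then \<open>\<alpha> \<inter> \<kappa>' \<subseteq> \<eta>\<close>, and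
  this new cover transposes up to one above \<open>\<kappa>'\<close>.
\<close>

lemma cover_index_bounded_inter:
  assumes \<kappa>: "\<kappa> \<in> D" "\<kappa>' \<in> D"
    and bounds: "cover_index_bounded X D N \<kappa>" "cover_index_bounded X D N \<kappa>'"
  shows "cover_index_bounded X D N (\<kappa> \<inter> \<kappa>')"
  unfolding cover_index_bounded_def
proof (intro allI impI ballI)
  fix \<eta> \<gamma> x assume cov: "covers D \<eta> \<gamma>" and above: "\<kappa> \<inter> \<kappa>' \<subseteq> \<eta>" and x: "x \<in> X"
  have D: "\<eta> \<in> D" "\<gamma> \<in> D" and sub: "\<eta> \<subseteq> \<gamma>"
    using cov by (simp_all add: covers_def psubset_imp_subset)
  show "card ((\<gamma> `` {x}) // \<eta>) \<le> N"
  proof (cases "\<gamma> \<inter> \<kappa> \<subseteq> \<eta>")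
    case True
    then show ?thesis
      using class_index_le_via_transpose[OF D(2,1) \<kappa>(1) cov _ bounds(1) x] by simp
  next
    case False
    define \<alpha> where "\<alpha> = \<gamma> \<inter> \<kappa>"
    have \<alpha>: "\<alpha> \<in> D" unfolding \<alpha>_def using D \<kappa> inter_closed by blast
    have "\<alpha> O \<eta> \<in> D" "\<eta> \<subseteq> \<alpha> O \<eta>"
      using comp_closed[OF \<alpha> D(1)] comp_upper2[OF \<alpha> D(1)] .
    moreover have "\<alpha> O \<eta> \<subseteq> \<gamma>"
      by (rule comp_least[OF D(2) _ sub]) (simp add: \<alpha>_def)
    ultimately have "\<alpha> O \<eta> = \<eta> \<or> \<alpha> O \<eta> = \<gamma>"
      using cov unfolding covers_def by simp
    then have join: "\<alpha> O \<eta> = \<gamma>"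
      using False comp_upper1[OF \<alpha> D(1)] unfolding \<alpha>_def by blast
    then have "covers D (\<alpha> \<inter> \<eta>) \<alpha>"
      using cover_transpose_down[OF \<alpha> D(1)] cov by simp
    moreover have "\<alpha> \<inter> \<kappa>' \<subseteq> \<alpha> \<inter> \<eta>"
      using above unfolding \<alpha>_def by blast
    ultimately have "card ((\<alpha> `` {x}) // (\<alpha> \<inter> \<eta>)) \<le> N"
      using class_index_le_via_transpose[OF \<alpha> inter_closed[OF \<alpha> D(1)] \<kappa>(2) _ _ bounds(2) x] by simp
    then show ?thesis
      using class_index_transpose[OF \<alpha> D(1)] join by simp
  qed
qed

end

section \<open>Congruences and homomorphic images\<close>

definition congruences :: "'f presentation \<Rightarrow> ('a, 'f) alg \<Rightarrow> 'a rel set" where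
  "congruences V A = {\<theta>. equiv (carrier A) \<theta> \<and>
    (\<forall>f \<in> symbols V. \<forall>xs ys. length xs = arity V f \<longrightarrow> list_all2 (\<lambda>x y. (x, y) \<in> \<theta>) xs ys \<longrightarrow>
      (oper A f xs, oper A f ys) \<in> \<theta>)}"

definition hom_kernel :: "('a, 'f) alg \<Rightarrow> ('a \<Rightarrow> 'b) \<Rightarrow> 'a rel" where
  "hom_kernel A h = {(x, y). x \<in> carrier A \<and> y \<in> carrier A \<and> h x = h y}"

lemma oper_closed:
  assumes "is_algebra V A" "f \<in> symbols V" "length xs = arity V f" "set xs \<subseteq> carrier A"
  shows "oper A f xs \<in> carrier A"
  using assms unfolding is_algebra_def by metis

lemma oper_undefined:
  assumes "is_algebra V A" "\<not> (f \<in> symbols V \<and> length xs = arity V f \<and> set xs \<subseteq> carrier A)"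
  shows "oper A f xs = undefined"
  using assms unfolding is_algebra_def by metis

lemma congruence_equiv: "\<theta> \<in> congruences V A \<Longrightarrow> equiv (carrier A) \<theta>"
  by (simp add: congruences_def)

lemma congruence_oper:
  assumes "\<theta> \<in> congruences V A" "f \<in> symbols V" "length xs = arity V f"
    "list_all2 (\<lambda>x y. (x, y) \<in> \<theta>) xs ys"
  shows "(oper A f xs, oper A f ys) \<in> \<theta>"
  using assms unfolding congruences_def by blast

lemma equiv_Id_on: "equiv X (Id_on X)"
  by (auto simp: equiv_def refl_on_def sym_def trans_def)

lemma Id_on_congruence:
  assumes "is_algebra V A"
  shows "Id_on (carrier A) \<in> congruences V A"
proof -
  have "(oper A f xs, oper A f ys) \<in> Id_on (carrier A)"
    if f: "f \<in> symbols V" "length xs = arity V f"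
      and xs: "list_all2 (\<lambda>x y. (x, y) \<in> Id_on (carrier A)) xs ys" for f xs ys
  proof -
    have "xs = ys" "set xs \<subseteq> carrier A"
      using xs by (auto simp: list_all2_conv_all_nth in_set_conv_nth intro!: nth_equalityI)
    then show ?thesis using oper_closed[OF assms f] by auto
  qed
  then show ?thesis by (simp add: congruences_def equiv_Id_on)
qed

lemma full_congruence:
  assumes "is_algebra V A"
  shows "carrier A \<times> carrier A \<in> congruences V A"
proof -
  have "(oper A f xs, oper A f ys) \<in> carrier A \<times> carrier A"
    if f: "f \<in> symbols V" "length xs = arity V f"
      and xs: "list_all2 (\<lambda>x y. (x, y) \<in> carrier A \<times> carrier A) xs ys" for f xs ys
  proof -
    have "length ys = arity V f" "set xs \<subseteq> carrier A" "set ys \<subseteq> carrier A"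
      using xs f(2) by (auto simp: list_all2_conv_all_nth in_set_conv_nth)
    then show ?thesis using oper_closed[OF assms] f by blast
  qed
  moreover have "equiv (carrier A) (carrier A \<times> carrier A)"
    by (auto simp: equiv_def refl_on_def sym_def trans_def)
  ultimately show ?thesis by (simp add: congruences_def)
qed

lemma congruence_inter:
  assumes "\<theta> \<in> congruences V A" "\<theta>' \<in> congruences V A"
  shows "\<theta> \<inter> \<theta>' \<in> congruences V A"
proof -
  have "equiv (carrier A) (\<theta> \<inter> \<theta>')"
    using congruence_equiv[OF assms(1)] congruence_equiv[OF assms(2)]
    by (simp add: equiv_def refl_on_def sym_Int trans_Int le_infI1)
  moreover have "(oper A f xs, oper A f ys) \<in> \<theta> \<inter> \<theta>'"
    if "f \<in> symbols V" "length xs = arity V f" "list_all2 (\<lambda>x y. (x, y) \<in> \<theta> \<inter> \<theta>') xs ys" for f xs ys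
  proof -
    have "list_all2 (\<lambda>x y. (x, y) \<in> \<theta>) xs ys" "list_all2 (\<lambda>x y. (x, y) \<in> \<theta>') xs ys"
      using that(3) by (auto elim: list_all2_mono)
    then show ?thesis
      using congruence_oper[OF assms(1) that(1,2)] congruence_oper[OF assms(2) that(1,2)] by simp
  qed
  ultimately show ?thesis by (simp add: congruences_def)
qed

lemma congruence_eval:
  assumes \<theta>: "\<theta> \<in> congruences V A" and v: "\<And>i. (v i, w i) \<in> \<theta>" and t: "wf_trm V t"
  shows "(eval (oper A) v t, eval (oper A) w t) \<in> \<theta>"
  using t
proof induction
  case (wf_Op f ts)
  have "list_all2 (\<lambda>x y. (x, y) \<in> \<theta>) (map (eval (oper A) v) ts) (map (eval (oper A) w) ts)"
    using wf_Op by (auto simp: list_all2_conv_all_nth)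
  then show ?case using congruence_oper[OF \<theta> wf_Op(1)] wf_Op(2) by simp
qed (simp add: v)

text \<open>
  The interpretation of the Mal'cev term as a function on \<open>A\<close>, which every congruence respects because
  it is a term function.
\<close>

lemma malcev_operation:
  fixes A :: "('a, 'f) alg"
  assumes V: "malcev_variety V" and A: "is_algebra V A"
  obtains m :: "'a \<Rightarrow> 'a \<Rightarrow> 'a \<Rightarrow> 'a" where
    "\<And>x z. \<lbrakk>x \<in> carrier A; z \<in> carrier A\<rbrakk> \<Longrightarrow> m x x z = z"
    "\<And>x z. \<lbrakk>x \<in> carrier A; z \<in> carrier A\<rbrakk> \<Longrightarrow> m x z z = x"
    "\<And>\<theta> x x' y y' z z'. \<lbrakk>\<theta> \<in> congruences V A; (x, x') \<in> \<theta>; (y, y') \<in> \<theta>; (z, z') \<in> \<theta>\<rbrakk>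
      \<Longrightarrow> (m x y z, m x' y' z') \<in> \<theta>"
proof -
  obtain T where T: "wf_trm V T"
    and T1: "satisfies V (apply_ternary T (Var 0) (Var 0) (Var 1)) (Var 1)"
    and T2: "satisfies V (apply_ternary T (Var 0) (Var 1) (Var 1)) (Var 0)"
    and var: "is_variety V"
    using V unfolding malcev_variety_def Let_def by blast
  define m where "m x y z = eval (oper A) (\<lambda>i. if i = 0 then x else if i = 1 then y else z) T"
    for x y z
  have eval_apply: "eval (oper A) v (apply_ternary T r s t)
      = m (eval (oper A) v r) (eval (oper A) v s) (eval (oper A) v t)" for v r s t
    unfolding apply_ternary_def eval_subst m_def by (rule arg_cong[of _ _ "\<lambda>v. eval _ v T"]) auto
  show ?thesis
  proof (rule that[of m])
    fix x z assume xz: "x \<in> carrier A" "z \<in> carrier A"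
    define v where "v i = (if i = 0 then x else z)" for i :: nat
    have v: "range v \<subseteq> carrier A" using xz by (auto simp: v_def)
    have "v 0 = x" "v 1 = z" by (simp_all add: v_def)
    then show "m x x z = z" "m x z z = x"
      using satisfies_sound[OF var A T1] satisfies_sound[OF var A T2] v
      unfolding holds_in_def eval_apply by auto
  next
    fix \<theta> x x' y y' z z'
    assume "\<theta> \<in> congruences V A" "(x, x') \<in> \<theta>" "(y, y') \<in> \<theta>" "(z, z') \<in> \<theta>"
    then show "(m x y z, m x' y' z') \<in> \<theta>"
      unfolding m_def by (intro congruence_eval[OF _ _ T]) auto
  qed
qed

text \<open>
  If \<open>x \<alpha> y \<beta> z\<close>, then \<open>m x y z\<close> is \<open>\<beta>\<close>-equivalent to \<open>m x y y = x\<close> and \<open>\<alpha>\<close>-equivalent to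
  \<open>m y y z = z\<close>.
\<close>

lemma congruences_permute:
  assumes V: "malcev_variety V" and A: "is_algebra V A"
    and cong: "\<alpha> \<in> congruences V A" "\<beta> \<in> congruences V A"
  shows "\<alpha> O \<beta> \<subseteq> \<beta> O \<alpha>"
proof clarify
  fix x y z assume xy: "(x, y) \<in> \<alpha>" and yz: "(y, z) \<in> \<beta>"
  have eq: "equiv (carrier A) \<alpha>" "equiv (carrier A) \<beta>"
    using cong congruence_equiv by auto
  have carr: "x \<in> carrier A" "y \<in> carrier A" "z \<in> carrier A"
    using xy yz equiv_type[OF eq(1)] equiv_type[OF eq(2)] by auto
  have refl: "(u, u) \<in> \<alpha>" "(u, u) \<in> \<beta>" if "u \<in> carrier A" for u
    using that eq by (auto simp: equiv_def refl_on_def)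
  obtain m where m: "m y y z = z" "m x y y = x"
    and m_cong: "\<And>\<theta> x x' y y' z z'. \<lbrakk>\<theta> \<in> congruences V A; (x, x') \<in> \<theta>; (y, y') \<in> \<theta>; (z, z') \<in> \<theta>\<rbrakk>
      \<Longrightarrow> (m x y z, m x' y' z') \<in> \<theta>"
    using malcev_operation[OF V A] carr by metis
  have "(m x y y, m x y z) \<in> \<beta>"
    by (rule m_cong[OF cong(2)]) (use refl carr yz in auto)
  moreover have "(m x y z, m y y z) \<in> \<alpha>"
    by (rule m_cong[OF cong(1)]) (use refl carr xy in auto)
  ultimately show "(x, z) \<in> \<beta> O \<alpha>" using m by auto
qed

lemma congruence_comp:
  assumes V: "malcev_variety V" and A: "is_algebra V A"
    and cong: "\<alpha> \<in> congruences V A" "\<beta> \<in> congruences V A"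
  shows "\<alpha> O \<beta> \<in> congruences V A"
proof -
  have eq: "equiv (carrier A) \<alpha>" "equiv (carrier A) \<beta>"
    using cong congruence_equiv by auto
  have comm: "\<alpha> O \<beta> = \<beta> O \<alpha>"
    using congruences_permute[OF V A] cong by blast
  have conv: "\<alpha>\<inverse> = \<alpha>" "\<beta>\<inverse> = \<beta>"
    using eq by (auto simp: equiv_def sym_conv_converse_eq)
  have idem: "\<alpha> O \<alpha> \<subseteq> \<alpha>" "\<beta> O \<beta> \<subseteq> \<beta>"
    using eq by (auto simp: equiv_def trans_O_subset)
  have "equiv (carrier A) (\<alpha> O \<beta>)"
  proof (rule equivI)
    show "\<alpha> O \<beta> \<subseteq> carrier A \<times> carrier A"
      using eq by (auto simp: equiv_def)
    show "refl_on (carrier A) (\<alpha> O \<beta>)"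
      using eq by (auto simp: equiv_def refl_on_def)
    show "sym (\<alpha> O \<beta>)"
      using comm conv by (simp add: sym_conv_converse_eq converse_relcomp)
    have "(\<alpha> O \<beta>) O (\<alpha> O \<beta>) = (\<alpha> O \<alpha>) O (\<beta> O \<beta>)"
      using comm by (metis O_assoc)
    also have "\<dots> \<subseteq> \<alpha> O \<beta>" using idem by (rule relcomp_mono)
    finally show "trans (\<alpha> O \<beta>)" unfolding trans_def by blast
  qed
  moreover have "(oper A f xs, oper A f ys) \<in> \<alpha> O \<beta>"
    if f: "f \<in> symbols V" "length xs = arity V f"
      and xs: "list_all2 (\<lambda>x y. (x, y) \<in> \<alpha> O \<beta>) xs ys" for f xs ys
  proof -
    have "list_all2 ((\<lambda>x y. (x, y) \<in> \<alpha>) OO (\<lambda>x y. (x, y) \<in> \<beta>)) xs ys"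
      using xs by (rule list_all2_mono) auto
    then obtain zs where "list_all2 (\<lambda>x y. (x, y) \<in> \<alpha>) xs zs" "list_all2 (\<lambda>x y. (x, y) \<in> \<beta>) zs ys"
      unfolding list.rel_compp by blast
    moreover from this(1) f(2) have "length zs = arity V f"
      by (simp add: list_all2_lengthD)
    ultimately show ?thesis
      using congruence_oper[OF cong(1) f, of zs] congruence_oper[OF cong(2) f(1), of zs ys]
      by (simp add: relcomp.relcompI)
  qed
  ultimately show ?thesis by (simp add: congruences_def)
qed

lemma congruences_permuting_equivalences:
  assumes "malcev_variety V" "is_algebra V A"
  shows "permuting_equivalences (carrier A) (congruences V A)"
  using assms congruence_equiv congruence_inter congruence_comp by unfold_locales auto

lemma surj_homsD:
  assumes "h \<in> surj_homs V A B"
  shows "h \<in> extensional (carrier A)" "h ` carrier A = carrier B"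
    "\<And>f xs. \<lbrakk>f \<in> symbols V; length xs = arity V f; set xs \<subseteq> carrier A\<rbrakk>
      \<Longrightarrow> h (oper A f xs) = oper B f (map h xs)"
  using assms by (auto simp: surj_homs_def)

lemma surj_hom_in: "\<lbrakk>h \<in> surj_homs V A B; x \<in> carrier A\<rbrakk> \<Longrightarrow> h x \<in> carrier B"
  using surj_homsD(2) by blast

lemma lift_list:
  assumes "set ys \<subseteq> h ` X"
  obtains xs where "set xs \<subseteq> X" "ys = map h xs" "length xs = length ys"
proof (rule that)
  show "set (map (inv_into X h) ys) \<subseteq> X" using assms by (auto intro!: inv_into_into)
  show "ys = map h (map (inv_into X h) ys)"
    using assms by (auto simp: f_inv_into_f subset_iff intro!: nth_equalityI)
qed simp

lemma hom_kernel_congruence: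
  assumes A: "is_algebra V A" and h: "h \<in> surj_homs V A B"
  shows "hom_kernel A h \<in> congruences V A"
proof -
  have "equiv (carrier A) (hom_kernel A h)"
    by (auto simp: hom_kernel_def equiv_def refl_on_def sym_def trans_def)
  moreover have "(oper A f xs, oper A f ys) \<in> hom_kernel A h"
    if f: "f \<in> symbols V" "length xs = arity V f"
      and xs: "list_all2 (\<lambda>x y. (x, y) \<in> hom_kernel A h) xs ys" for f xs ys
  proof -
    have carr: "length ys = arity V f" "set xs \<subseteq> carrier A" "set ys \<subseteq> carrier A"
      using xs f(2) by (auto simp: list_all2_conv_all_nth in_set_conv_nth hom_kernel_def)
    moreover have "map h xs = map h ys"
      using xs by (auto simp: list_all2_conv_all_nth hom_kernel_def intro!: nth_equalityI)
    ultimately show ?thesis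
      using surj_homsD(3)[OF h f] surj_homsD(3)[OF h f(1)] oper_closed[OF A f] oper_closed[OF A f(1)]
      by (simp add: hom_kernel_def)
  qed
  ultimately show ?thesis by (simp add: congruences_def)
qed

text \<open>
  The structure that makes \<open>h\<close> a homomorphism, provided that the kernel of \<open>h\<close> is a congruence.  With \<open>h\<close>
  choosing representatives of classes it is a quotient algebra whose elements have the same type as
  those of \<open>A\<close>; with \<open>h\<close> injective it is an isomorphic copy of \<open>A\<close> on another set.
\<close>

definition image_algebra :: "'f presentation \<Rightarrow> ('a, 'f) alg \<Rightarrow> ('a \<Rightarrow> 'a) \<Rightarrow> ('a, 'f) alg" where
  "image_algebra V A h = \<lparr> carrier = h ` carrier A,
     oper = (\<lambda>f ys. if f \<in> symbols V \<and> length ys = arity V f \<and> set ys \<subseteq> h ` carrier A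
       then h (oper A f (map (inv_into (carrier A) h) ys)) else undefined) \<rparr>"

lemma carrier_image_algebra: "carrier (image_algebra V A h) = h ` carrier A"
  by (simp add: image_algebra_def)

text \<open>
  The preimage chosen by \<^const>\<open>inv_into\<close> may differ from \<open>xs\<close>, but only by elements of the kernel.
\<close>

lemma image_algebra_oper:
  assumes A: "is_algebra V A" and cong: "hom_kernel A h \<in> congruences V A"
    and f: "f \<in> symbols V" "length xs = arity V f" and xs: "set xs \<subseteq> carrier A"
  shows "oper (image_algebra V A h) f (map h xs) = h (oper A f xs)"
proof -
  let ?g = "inv_into (carrier A) h"
  have "list_all2 (\<lambda>x y. (x, y) \<in> hom_kernel A h) xs (map ?g (map h xs))"
    using xs by (auto simp: list_all2_conv_all_nth hom_kernel_def f_inv_into_f subset_iff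
        intro!: inv_into_into)
  then have "(oper A f xs, oper A f (map ?g (map h xs))) \<in> hom_kernel A h"
    using congruence_oper[OF cong f] by blast
  then have "h (oper A f (map ?g (map h xs))) = h (oper A f xs)"
    by (simp add: hom_kernel_def)
  moreover have "set (map h xs) \<subseteq> h ` carrier A" using xs by auto
  ultimately show ?thesis using f by (simp add: image_algebra_def)
qed

lemma image_algebra_eval:
  assumes A: "is_algebra V A" and cong: "hom_kernel A h \<in> congruences V A"
    and v: "range v \<subseteq> carrier A" and t: "wf_trm V t"
  shows "eval (oper (image_algebra V A h)) (\<lambda>i. h (v i)) t = h (eval (oper A) v t)"
  using t
proof induction
  case (wf_Op f ts)
  have "set (map (eval (oper A) v) ts) \<subseteq> carrier A"
    using eval_closed[OF A v] wf_Op(3) by auto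
  then have "oper (image_algebra V A h) f (map h (map (eval (oper A) v) ts))
      = h (oper A f (map (eval (oper A) v) ts))"
    by (intro image_algebra_oper[OF A cong wf_Op(1)]) (simp add: wf_Op(2))
  moreover have "map (eval (oper (image_algebra V A h)) (\<lambda>i. h (v i))) ts
      = map h (map (eval (oper A) v) ts)"
    using wf_Op by simp
  ultimately show ?case by (simp only: eval.simps)
qed simp

lemma image_algebra_is_algebra:
  assumes V: "is_variety V" and A: "is_algebra V A" and cong: "hom_kernel A h \<in> congruences V A"
  shows "is_algebra V (image_algebra V A h)"
  unfolding is_algebra_def
proof (intro conjI allI)
  fix f ys
  let ?B = "image_algebra V A h"
  have "oper ?B f ys \<in> carrier ?B"
    if f: "f \<in> symbols V" "length ys = arity V f" and ys: "set ys \<subseteq> carrier ?B"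
  proof -
    obtain xs where "set xs \<subseteq> carrier A" "ys = map h xs" "length xs = length ys"
      using lift_list ys unfolding carrier_image_algebra by metis
    then show ?thesis
      using image_algebra_oper[OF A cong f(1)] f(2) oper_closed[OF A f(1)]
      by (simp add: carrier_image_algebra)
  qed
  then show "if f \<in> symbols V \<and> length ys = arity V f \<and> set ys \<subseteq> carrier ?B
      then oper ?B f ys \<in> carrier ?B else oper ?B f ys = undefined"
    by (simp add: image_algebra_def)
next
  show "\<forall>(s, t) \<in> equations V. holds_in (image_algebra V A h) s t"
  proof (clarify, unfold holds_in_def, intro allI impI)
    fix s t and v :: "nat \<Rightarrow> 'b"
    assume st: "(s, t) \<in> equations V" and v: "range v \<subseteq> carrier (image_algebra V A h)"
    then have "\<forall>i. \<exists>x. x \<in> carrier A \<and> v i = h x"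
      unfolding carrier_image_algebra by blast
    then obtain w where w: "\<And>i. w i \<in> carrier A" "v = (\<lambda>i. h (w i))"
      by metis
    then have range: "range w \<subseteq> carrier A" by blast
    have wf: "wf_trm V s" "wf_trm V t" using V st by (auto simp: is_variety_def)
    have "eval (oper A) w s = eval (oper A) w t"
      using A st range unfolding is_algebra_def holds_in_def by blast
    then show "eval (oper (image_algebra V A h)) v s = eval (oper (image_algebra V A h)) v t"
      unfolding w(2) image_algebra_eval[OF A cong range wf(1)]
        image_algebra_eval[OF A cong range wf(2)] by simp
  qed
qed

lemma image_algebra_hom:
  assumes A: "is_algebra V A" and cong: "hom_kernel A h \<in> congruences V A"
  shows "restrict h (carrier A) \<in> surj_homs V A (image_algebra V A h)"
proof -
  have "restrict h (carrier A) (oper A f xs)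
      = oper (image_algebra V A h) f (map (restrict h (carrier A)) xs)"
    if f: "f \<in> symbols V" "length xs = arity V f" and xs: "set xs \<subseteq> carrier A" for f xs
  proof -
    have eq: "map (restrict h (carrier A)) xs = map h xs" using xs by auto
    show ?thesis unfolding eq
      using image_algebra_oper[OF A cong f xs] oper_closed[OF A f xs] by simp
  qed
  then show ?thesis by (simp add: surj_homs_def carrier_image_algebra)
qed

lemma hom_kernel_restrict: "hom_kernel A (restrict h (carrier A)) = hom_kernel A h"
  by (auto simp: hom_kernel_def)

lemma surj_hom_factor:
  assumes A: "is_algebra V A" and h: "h \<in> surj_homs V A H" and k: "k \<in> surj_homs V A F"
    and sub: "hom_kernel A h \<subseteq> hom_kernel A k"
  obtains g where "g \<in> surj_homs V H F" "compose (carrier A) g h = k"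
proof -
  define g where "g = restrict (\<lambda>y. k (inv_into (carrier A) h y)) (carrier H)"
  have g: "g (h x) = k x" if x: "x \<in> carrier A" for x
  proof -
    let ?x = "inv_into (carrier A) h (h x)"
    have "?x \<in> carrier A" "h ?x = h x"
      using x by (auto intro!: inv_into_into f_inv_into_f)
    then have "(?x, x) \<in> hom_kernel A h" using x by (simp add: hom_kernel_def)
    then have "k ?x = k x" using sub by (auto simp: hom_kernel_def)
    then show ?thesis using surj_hom_in[OF h x] by (simp add: g_def)
  qed
  have "g (oper H f ys) = oper F f (map g ys)"
    if f: "f \<in> symbols V" "length ys = arity V f" and ys: "set ys \<subseteq> carrier H" for f ys
  proof -
    obtain xs where xs: "set xs \<subseteq> carrier A" "ys = map h xs" "length xs = length ys"
      using lift_list ys unfolding surj_homsD(2)[OF h, symmetric] by metis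
    have eq: "map g ys = map k xs" using xs(1) g unfolding xs(2) by auto
    have "oper H f ys = h (oper A f xs)" "oper F f (map k xs) = k (oper A f xs)"
      using surj_homsD(3)[OF h f(1)] surj_homsD(3)[OF k f(1)] xs f(2) by simp_all
    moreover have "oper A f xs \<in> carrier A" using oper_closed[OF A f(1)] xs f(2) by simp
    ultimately show ?thesis unfolding eq using g by simp
  qed
  moreover have "g ` carrier H = carrier F"
    unfolding surj_homsD(2)[OF h, symmetric] surj_homsD(2)[OF k, symmetric] image_image
    by (rule image_cong) (simp_all add: g)
  ultimately have "g \<in> surj_homs V H F"
    by (simp add: surj_homs_def g_def)
  moreover have "compose (carrier A) g h = k"
    using surj_homsD(1)[OF k] g by (auto simp: compose_def extensional_def restrict_def)
  ultimately show ?thesis by (rule that)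
qed

lemma compose_surj_hom:
  assumes A: "is_algebra V A" and h: "h \<in> surj_homs V A B" and g: "g \<in> surj_homs V B D"
  shows "compose (carrier A) g h \<in> surj_homs V A D"
proof -
  have "compose (carrier A) g h (oper A f xs) = oper D f (map (compose (carrier A) g h) xs)"
    if f: "f \<in> symbols V" "length xs = arity V f" and xs: "set xs \<subseteq> carrier A" for f xs
  proof -
    have "set (map h xs) \<subseteq> carrier B" using xs surj_hom_in[OF h] by auto
    then have "g (h (oper A f xs)) = oper D f (map g (map h xs))"
      using surj_homsD(3)[OF h f xs] surj_homsD(3)[OF g f(1)] f(2) by simp
    moreover have eq: "map (compose (carrier A) g h) xs = map g (map h xs)"
      using xs by (auto simp: compose_def)
    ultimately show ?thesis unfolding eq using oper_closed[OF A f xs] by (simp add: compose_def)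
  qed
  moreover have "compose (carrier A) g h ` carrier A = carrier D"
    unfolding surj_homsD(2)[OF g, symmetric] surj_homsD(2)[OF h, symmetric] image_image
    by (rule image_cong) (simp_all add: compose_def)
  ultimately show ?thesis by (simp add: surj_homs_def)
qed

lemma id_surj_hom:
  assumes A: "is_algebra V A"
  shows "(\<lambda>x \<in> carrier A. x) \<in> surj_homs V A A"
proof -
  have eq: "map (\<lambda>x \<in> carrier A. x) xs = xs" if "set xs \<subseteq> carrier A" for xs
    using that by (intro map_idI) auto
  have "(\<lambda>x \<in> carrier A. x) (oper A f xs) = oper A f (map (\<lambda>x \<in> carrier A. x) xs)"
    if "f \<in> symbols V" "length xs = arity V f" "set xs \<subseteq> carrier A" for f xs
    unfolding eq[OF that(3)] using oper_closed[OF A that] by simp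
  then show ?thesis by (simp add: surj_homs_def)
qed

lemma hom_kernel_eq_Id_on_iff: "hom_kernel A h = Id_on (carrier A) \<longleftrightarrow> inj_on h (carrier A)"
  by (auto simp: hom_kernel_def inj_on_def)

section \<open>The category of finite algebras and its quotients\<close>

lemma finite_algebra_category_simps [simp]:
  "Obj (finite_algebra_category V) = {A. is_algebra V A \<and> finite (carrier A)}"
  "Hom (finite_algebra_category V) = surj_homs V"
  "Id (finite_algebra_category V) = (\<lambda>A. \<lambda>x \<in> carrier A. x)"
  "Comp (finite_algebra_category V) = (\<lambda>A B D g h. compose (carrier A) g h)"
  by (simp_all add: finite_algebra_category_def)

lemma category_finite_algebra_category:
  fixes V :: "'f presentation"
  shows "category (finite_algebra_category V :: (('a, 'f) alg, 'a \<Rightarrow> 'a) cat)"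
proof
  fix A B D E :: "('a, 'f) alg" and h g k
  assume "h \<in> Hom (finite_algebra_category V) A B"
  then have h: "h \<in> surj_homs V A B" by simp
  show "Comp (finite_algebra_category V) A A B h (Id (finite_algebra_category V) A) = h"
    using surj_homsD(1)[OF h] by (auto simp: compose_def extensional_def)
  show "Comp (finite_algebra_category V) A B B (Id (finite_algebra_category V) B) h = h"
    using surj_homsD(1)[OF h] surj_hom_in[OF h] by (auto simp: compose_def extensional_def)
  show "Comp (finite_algebra_category V) A B E (Comp (finite_algebra_category V) B D E k g) h
      = Comp (finite_algebra_category V) A D E k (Comp (finite_algebra_category V) A B D g h)"
    using surj_hom_in[OF h] by (auto simp: compose_def)
qed (simp_all add: id_surj_hom compose_surj_hom)

text \<open>
  Morphisms are surjective, hence can be cancelled on the right.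
\<close>

lemma is_epi_iff:
  fixes A B :: "('a, 'f) alg"
  shows "is_epi (finite_algebra_category V) A B f \<longleftrightarrow> f \<in> surj_homs V A B"
proof -
  have "g = h"
    if f: "f \<in> surj_homs V A B" and g: "g \<in> surj_homs V B X" and h: "h \<in> surj_homs V B X"
      and eq: "compose (carrier A) g f = compose (carrier A) h f" for X :: "('a, 'f) alg" and g h
  proof (rule extensionalityI[OF surj_homsD(1)[OF g] surj_homsD(1)[OF h]])
    fix y assume "y \<in> carrier B"
    then obtain x where "x \<in> carrier A" "y = f x" using surj_homsD(2)[OF f] by blast
    then show "g y = h y" using fun_cong[OF eq, of x] by (simp add: compose_def)
  qed
  then show ?thesis by (auto simp: is_epi_def)
qed

lemma hom_kernel_id: "hom_kernel G (\<lambda>x \<in> carrier G. x) = Id_on (carrier G)"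
  by (auto simp: hom_kernel_def)

lemma is_iso_iff:
  assumes A: "is_algebra V A"
  shows "is_iso (finite_algebra_category V) A B f \<longleftrightarrow> f \<in> surj_homs V A B \<and> inj_on f (carrier A)"
proof
  assume "is_iso (finite_algebra_category V) A B f"
  then obtain g where f: "f \<in> surj_homs V A B"
    and gf: "compose (carrier A) g f = (\<lambda>x \<in> carrier A. x)"
    by (auto simp: is_iso_def)
  have "inj_on f (carrier A)"
  proof (rule inj_on_inverseI)
    fix x assume "x \<in> carrier A"
    then show "g (f x) = x" using fun_cong[OF gf, of x] by (simp add: compose_def)
  qed
  then show "f \<in> surj_homs V A B \<and> inj_on f (carrier A)" using f by blast
next
  assume asm: "f \<in> surj_homs V A B \<and> inj_on f (carrier A)"
  then have f: "f \<in> surj_homs V A B" and inj: "inj_on f (carrier A)" by blast+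
  have "hom_kernel A f \<subseteq> hom_kernel A (\<lambda>x \<in> carrier A. x)"
    using inj by (simp add: hom_kernel_id hom_kernel_eq_Id_on_iff[THEN iffD2])
  then obtain g where g: "g \<in> surj_homs V B A" "compose (carrier A) g f = (\<lambda>x \<in> carrier A. x)"
    using surj_hom_factor[OF A f id_surj_hom[OF A]] by blast
  have "compose (carrier B) f g = (\<lambda>y \<in> carrier B. y)"
  proof
    fix y
    show "compose (carrier B) f g y = (\<lambda>y \<in> carrier B. y) y"
    proof (cases "y \<in> carrier B")
      case True
      then obtain x where x: "x \<in> carrier A" "y = f x" using surj_homsD(2)[OF f] by blast
      then have "g y = x" using fun_cong[OF g(2), of x] by (simp add: compose_def)
      then show ?thesis using x True by (simp add: compose_def)
    qed (simp add: compose_def)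
  qed
  then show "is_iso (finite_algebra_category V) A B f" using f g by (auto simp: is_iso_def)
qed

lemma iso_class_eqI:
  fixes A B :: "('a, 'f) alg"
  assumes A: "is_algebra V A" and B: "is_algebra V B"
    and f: "is_iso (finite_algebra_category V) A B f"
  shows "iso_class (finite_algebra_category V) A = iso_class (finite_algebra_category V) B"
proof -
  let ?C = "finite_algebra_category V :: (('a, 'f) alg, 'a \<Rightarrow> 'a) cat"
  have trans: "isomorphic ?C X Z"
    if X: "is_algebra V X" "is_algebra V Y" and fg: "is_iso ?C X Y f" "is_iso ?C Y Z g" for X Y Z f g
  proof -
    have f: "f \<in> surj_homs V X Y" "inj_on f (carrier X)"
      and g: "g \<in> surj_homs V Y Z" "inj_on g (carrier Y)"
      using fg is_iso_iff X by blast+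
    have "inj_on (compose (carrier X) g f) (carrier X)"
      using f(2) g(2) surj_hom_in[OF f(1)] by (auto simp: inj_on_def compose_def)
    then have "is_iso ?C X Z (compose (carrier X) g f)"
      using is_iso_iff[OF X(1)] compose_surj_hom[OF X(1) f(1) g(1)] by blast
    then show ?thesis unfolding isomorphic_def by blast
  qed
  obtain g where g: "is_iso ?C B A g" using f unfolding is_iso_def by auto
  have "isomorphic ?C A X \<longleftrightarrow> isomorphic ?C B X" for X
  proof
    assume "isomorphic ?C A X"
    then obtain k where "is_iso ?C A X k" unfolding isomorphic_def by blast
    then show "isomorphic ?C B X" by (rule trans[OF B A g])
  next
    assume "isomorphic ?C B X"
    then obtain k where "is_iso ?C B X k" unfolding isomorphic_def by blast
    then show "isomorphic ?C A X" by (rule trans[OF A B f])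
  qed
  then show ?thesis unfolding iso_class_def by simp
qed

lemma in_quotients_iff:
  "(F, \<pi>) \<in> quotients (finite_algebra_category V) G \<longleftrightarrow>
    is_algebra V F \<and> finite (carrier F) \<and> \<pi> \<in> surj_homs V G F"
  by (simp add: quotients_def is_epi_iff)

lemma id_quotient:
  assumes "is_algebra V G" "finite (carrier G)"
  shows "(G, \<lambda>x \<in> carrier G. x) \<in> quotients (finite_algebra_category V) G"
  using assms id_surj_hom by (simp add: in_quotients_iff)

lemma quotient_iso_rel_iff:
  assumes G: "is_algebra V G"
  shows "((F, \<pi>), (F', \<pi>')) \<in> quotient_iso_rel (finite_algebra_category V) G \<longleftrightarrow>
    (F, \<pi>) \<in> quotients (finite_algebra_category V) G \<and>
    (F', \<pi>') \<in> quotients (finite_algebra_category V) G \<and> hom_kernel G \<pi> = hom_kernel G \<pi>'"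
proof -
  have "(\<exists>\<rho>. is_iso (finite_algebra_category V) F F' \<rho> \<and> \<pi>' = compose (carrier G) \<rho> \<pi>)
      \<longleftrightarrow> hom_kernel G \<pi> = hom_kernel G \<pi>'"
    if F: "is_algebra V F" and \<pi>: "\<pi> \<in> surj_homs V G F" and \<pi>': "\<pi>' \<in> surj_homs V G F'"
  proof
    assume "\<exists>\<rho>. is_iso (finite_algebra_category V) F F' \<rho> \<and> \<pi>' = compose (carrier G) \<rho> \<pi>"
    then obtain \<rho> where "inj_on \<rho> (carrier F)" "\<pi>' = compose (carrier G) \<rho> \<pi>"
      using is_iso_iff[OF F] by blast
    then show "hom_kernel G \<pi> = hom_kernel G \<pi>'"
      using surj_hom_in[OF \<pi>] by (auto simp: hom_kernel_def compose_def inj_on_eq_iff)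
  next
    assume eq: "hom_kernel G \<pi> = hom_kernel G \<pi>'"
    then obtain \<rho> where \<rho>: "\<rho> \<in> surj_homs V F F'" "compose (carrier G) \<rho> \<pi> = \<pi>'"
      using surj_hom_factor[OF G \<pi> \<pi>'] by blast
    have "inj_on \<rho> (carrier F)"
    proof (rule inj_onI)
      fix y z assume "y \<in> carrier F" "z \<in> carrier F" and yz: "\<rho> y = \<rho> z"
      then obtain u w where uw: "u \<in> carrier G" "w \<in> carrier G" "y = \<pi> u" "z = \<pi> w"
        using surj_homsD(2)[OF \<pi>] by blast
      then have "\<pi>' u = \<pi>' w"
        using yz fun_cong[OF \<rho>(2), of u] fun_cong[OF \<rho>(2), of w] by (simp add: compose_def)
      then have "(u, w) \<in> hom_kernel G \<pi>" unfolding eq using uw by (simp add: hom_kernel_def)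
      then show "y = z" using uw by (simp add: hom_kernel_def)
    qed
    then show "\<exists>\<rho>. is_iso (finite_algebra_category V) F F' \<rho> \<and> \<pi>' = compose (carrier G) \<rho> \<pi>"
      using is_iso_iff[OF F] \<rho> by blast
  qed
  then show ?thesis
    unfolding quotient_iso_rel_def in_quotients_iff by auto
qed

text \<open>
  Meant for a class of isomorphic quotients, all of whose members have the same kernel.
\<close>

definition quotient_kernel :: "('a, 'f) alg \<Rightarrow> (('a, 'f) alg \<times> ('a \<Rightarrow> 'a)) set \<Rightarrow> 'a rel" where
  "quotient_kernel G X = hom_kernel G (snd (SOME q. q \<in> X))"

lemma in_quotient_class_iff:
  assumes "is_algebra V G" "(F, \<pi>) \<in> quotients (finite_algebra_category V) G"
  shows "(F', \<pi>') \<in> quotient_class (finite_algebra_category V) G (F, \<pi>) \<longleftrightarrow>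
    (F', \<pi>') \<in> quotients (finite_algebra_category V) G \<and> hom_kernel G \<pi>' = hom_kernel G \<pi>"
  unfolding quotient_class_def using quotient_iso_rel_iff[OF assms(1)] assms(2) by auto

lemma quotient_kernel_class:
  assumes G: "is_algebra V G" and q: "(F, \<pi>) \<in> quotients (finite_algebra_category V) G"
  shows "quotient_kernel G (quotient_class (finite_algebra_category V) G (F, \<pi>)) = hom_kernel G \<pi>"
proof -
  let ?X = "quotient_class (finite_algebra_category V) G (F, \<pi>)"
  have "(F, \<pi>) \<in> ?X" using in_quotient_class_iff[OF assms] q by blast
  then have "(SOME q. q \<in> ?X) \<in> ?X" by (rule someI)
  then show ?thesis
    unfolding quotient_kernel_def
    using in_quotient_class_iff[OF assms, of "fst (SOME q. q \<in> ?X)" "snd (SOME q. q \<in> ?X)"] by simp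
qed

lemma quotient_poset_carrierE:
  assumes "X \<in> carrier (quotient_poset (finite_algebra_category V) G)"
  obtains F \<pi> where "(F, \<pi>) \<in> quotients (finite_algebra_category V) G"
    "X = quotient_class (finite_algebra_category V) G (F, \<pi>)"
  using assms unfolding quotient_poset_def quotient_class_def quotient_def by auto

lemma quotient_class_in_carrier:
  assumes "(F, \<pi>) \<in> quotients (finite_algebra_category V) G"
  shows "quotient_class (finite_algebra_category V) G (F, \<pi>)
    \<in> carrier (quotient_poset (finite_algebra_category V) G)"
  using assms unfolding quotient_poset_def quotient_class_def quotient_def by auto

lemma quotient_class_le_iff:
  assumes G: "is_algebra V G"
    and F: "(F, \<pi>) \<in> quotients (finite_algebra_category V) G"
    and H: "(H, \<psi>) \<in> quotients (finite_algebra_category V) G"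
  shows "quotient_class (finite_algebra_category V) G (F, \<pi>)
      \<sqsubseteq>\<^bsub>quotient_poset (finite_algebra_category V) G\<^esub>
      quotient_class (finite_algebra_category V) G (H, \<psi>) \<longleftrightarrow> hom_kernel G \<psi> \<subseteq> hom_kernel G \<pi>"
    (is "?X \<sqsubseteq>\<^bsub>_\<^esub> ?Y \<longleftrightarrow> _")
proof
  assume "?X \<sqsubseteq>\<^bsub>quotient_poset (finite_algebra_category V) G\<^esub> ?Y"
  then obtain F' \<pi>' H' \<psi>' h where "(F', \<pi>') \<in> ?X" "(H', \<psi>') \<in> ?Y"
    and eq: "compose (carrier G) h \<psi>' = \<pi>'"
    by (auto simp: quotient_poset_def)
  then have "hom_kernel G \<pi>' = hom_kernel G \<pi>" "hom_kernel G \<psi>' = hom_kernel G \<psi>"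
    using in_quotient_class_iff[OF G F] in_quotient_class_iff[OF G H] by blast+
  moreover have "hom_kernel G \<psi>' \<subseteq> hom_kernel G \<pi>'"
    unfolding eq[symmetric] by (auto simp: hom_kernel_def compose_def)
  ultimately show "hom_kernel G \<psi> \<subseteq> hom_kernel G \<pi>" by simp
next
  assume sub: "hom_kernel G \<psi> \<subseteq> hom_kernel G \<pi>"
  obtain h where "h \<in> surj_homs V H F" "compose (carrier G) h \<psi> = \<pi>"
    using surj_hom_factor[OF G _ _ sub] F H unfolding in_quotients_iff by blast
  moreover have "(F, \<pi>) \<in> ?X" "(H, \<psi>) \<in> ?Y"
    using in_quotient_class_iff[OF G F] in_quotient_class_iff[OF G H] F H by blast+
  ultimately have "\<exists>x \<in> ?X. \<exists>y \<in> ?Y. \<exists>h \<in> surj_homs V (fst y) (fst x).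
      compose (carrier G) h (snd y) = snd x"
    by (intro bexI[of _ "(F, \<pi>)"] bexI[of _ "(H, \<psi>)"] bexI[of _ h]) simp_all
  then show "?X \<sqsubseteq>\<^bsub>quotient_poset (finite_algebra_category V) G\<^esub> ?Y"
    by (simp add: quotient_poset_def case_prod_unfold)
qed

lemma quotient_kernel_le_iff:
  assumes G: "is_algebra V G"
    and X: "X \<in> carrier (quotient_poset (finite_algebra_category V) G)"
    and Y: "Y \<in> carrier (quotient_poset (finite_algebra_category V) G)"
  shows "X \<sqsubseteq>\<^bsub>quotient_poset (finite_algebra_category V) G\<^esub> Y
    \<longleftrightarrow> quotient_kernel G Y \<subseteq> quotient_kernel G X"
proof -
  obtain F \<pi> where F: "(F, \<pi>) \<in> quotients (finite_algebra_category V) G"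
    and X_eq: "X = quotient_class (finite_algebra_category V) G (F, \<pi>)"
    using quotient_poset_carrierE[OF X] .
  obtain H \<psi> where H: "(H, \<psi>) \<in> quotients (finite_algebra_category V) G"
    and Y_eq: "Y = quotient_class (finite_algebra_category V) G (H, \<psi>)"
    using quotient_poset_carrierE[OF Y] .
  show ?thesis
    unfolding X_eq Y_eq quotient_kernel_class[OF G F] quotient_kernel_class[OF G H]
    by (rule quotient_class_le_iff[OF G F H])
qed

lemma inj_on_quotient_kernel:
  assumes G: "is_algebra V G"
  shows "inj_on (quotient_kernel G) (carrier (quotient_poset (finite_algebra_category V) G))"
proof (rule inj_onI)
  fix X Y
  assume X: "X \<in> carrier (quotient_poset (finite_algebra_category V) G)"
    and Y: "Y \<in> carrier (quotient_poset (finite_algebra_category V) G)"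
    and eq: "quotient_kernel G X = quotient_kernel G Y"
  obtain F \<pi> where F: "(F, \<pi>) \<in> quotients (finite_algebra_category V) G"
    and X_eq: "X = quotient_class (finite_algebra_category V) G (F, \<pi>)"
    using quotient_poset_carrierE[OF X] .
  obtain H \<psi> where H: "(H, \<psi>) \<in> quotients (finite_algebra_category V) G"
    and Y_eq: "Y = quotient_class (finite_algebra_category V) G (H, \<psi>)"
    using quotient_poset_carrierE[OF Y] .
  have "hom_kernel G \<pi> = hom_kernel G \<psi>"
    using eq unfolding X_eq Y_eq quotient_kernel_class[OF G F] quotient_kernel_class[OF G H] .
  then show "X = Y"
    unfolding X_eq Y_eq using in_quotient_class_iff[OF G F] in_quotient_class_iff[OF G H]
    by auto
qed

text \<open>
  The quotient by \<open>\<theta>\<close> is realised on representatives of the classes, which keeps its underlying set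
  inside the given type.
\<close>

lemma congruence_is_kernel:
  fixes G :: "('a, 'f) alg"
  assumes V: "is_variety V" and G: "is_algebra V G" "finite (carrier G)"
    and \<theta>: "\<theta> \<in> congruences V G"
  obtains F \<pi> where "(F, \<pi>) \<in> quotients (finite_algebra_category V) G" "hom_kernel G \<pi> = \<theta>"
proof -
  define h where "h x = (SOME y. y \<in> \<theta> `` {x})" for x
  have eq: "equiv (carrier G) \<theta>" using \<theta> by (rule congruence_equiv)
  have h: "(x, h x) \<in> \<theta>" if "x \<in> carrier G" for x
  proof -
    have "x \<in> \<theta> `` {x}" using equiv_class_self[OF eq that] .
    then have "h x \<in> \<theta> `` {x}" unfolding h_def by (rule someI)
    then show ?thesis by simp
  qed
  have "h x = h y \<longleftrightarrow> (x, y) \<in> \<theta>" if xy: "x \<in> carrier G" "y \<in> carrier G" for x y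
  proof
    assume "h x = h y"
    then have "(x, h x) \<in> \<theta>" "(y, h x) \<in> \<theta>" using h[OF xy(1)] h[OF xy(2)] by simp_all
    then show "(x, y) \<in> \<theta>" using eq unfolding equiv_def by (meson symD transD)
  next
    assume "(x, y) \<in> \<theta>"
    then have "\<theta> `` {x} = \<theta> `` {y}" using equiv_class_eq[OF eq] by blast
    then show "h x = h y" unfolding h_def by simp
  qed
  then have ker: "hom_kernel G h = \<theta>"
    using equiv_type[OF eq] by (auto simp: hom_kernel_def)
  then have cong: "hom_kernel G h \<in> congruences V G" using \<theta> by simp
  show ?thesis
  proof (rule that)
    show "(image_algebra V G h, restrict h (carrier G)) \<in> quotients (finite_algebra_category V) G"
      using image_algebra_is_algebra[OF V G(1) cong] image_algebra_hom[OF G(1) cong] G(2)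
      by (simp add: in_quotients_iff carrier_image_algebra)
    show "hom_kernel G (restrict h (carrier G)) = \<theta>"
      by (simp add: hom_kernel_restrict ker)
  qed
qed

lemma quotient_kernel_image:
  assumes V: "is_variety V" and G: "is_algebra V G" "finite (carrier G)"
  shows "quotient_kernel G ` carrier (quotient_poset (finite_algebra_category V) G) = congruences V G"
proof
  show "quotient_kernel G ` carrier (quotient_poset (finite_algebra_category V) G) \<subseteq> congruences V G"
  proof clarify
    fix X assume X: "X \<in> carrier (quotient_poset (finite_algebra_category V) G)"
    obtain F \<pi> where F: "(F, \<pi>) \<in> quotients (finite_algebra_category V) G"
      and X_eq: "X = quotient_class (finite_algebra_category V) G (F, \<pi>)"
      using quotient_poset_carrierE[OF X] .
    show "quotient_kernel G X \<in> congruences V G"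
      unfolding X_eq quotient_kernel_class[OF G(1) F]
      using F hom_kernel_congruence[OF G(1)] unfolding in_quotients_iff by blast
  qed
  show "congruences V G \<subseteq> quotient_kernel G ` carrier (quotient_poset (finite_algebra_category V) G)"
  proof
    fix \<theta> assume "\<theta> \<in> congruences V G"
    then obtain F \<pi> where F: "(F, \<pi>) \<in> quotients (finite_algebra_category V) G"
      and ker: "hom_kernel G \<pi> = \<theta>"
      using congruence_is_kernel[OF V G] by blast
    show "\<theta> \<in> quotient_kernel G ` carrier (quotient_poset (finite_algebra_category V) G)"
      unfolding ker[symmetric] quotient_kernel_class[OF G(1) F, symmetric]
      using quotient_class_in_carrier[OF F] by blast
  qed
qed

lemma modular_lattice_quotients:
  assumes V: "malcev_variety V" and G: "is_algebra V G" "finite (carrier G)"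
  shows "modular_lattice (quotient_poset (finite_algebra_category V) G)"
proof -
  interpret permuting_equivalences "carrier G" "congruences V G"
    using congruences_permuting_equivalences[OF V G(1)] .
  have "is_variety V" using V by (simp add: malcev_variety_def)
  then show ?thesis
    using modular_lattice_of_dual_embedding[OF _ inj_on_quotient_kernel[OF G(1)]
        quotient_kernel_image[OF _ G] quotient_kernel_le_iff[OF G(1)]]
    by (simp add: quotient_poset_def)
qed

lemma finite_quotients:
  assumes V: "is_variety V" and G: "is_algebra V G" "finite (carrier G)"
  shows "finite (carrier (quotient_poset (finite_algebra_category V) G))"
proof -
  have "congruences V G \<subseteq> Pow (carrier G \<times> carrier G)"
    using congruence_equiv equiv_type by blast
  then have "finite (congruences V G)" using G(2) by (simp add: finite_subset)
  then show ?thesis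
    using finite_imageD[OF _ inj_on_quotient_kernel[OF G(1)]] quotient_kernel_image[OF assms] by simp
qed

text \<open>
  The interval above \<open>G\<close> in the poset of quotients of \<open>H\<close> is the interval below the kernel in the lattice
  of congruences.
\<close>

lemma simple_epi_covers:
  assumes V: "is_variety V" and H: "is_algebra V H" "finite (carrier H)"
    and G: "is_algebra V G" "finite (carrier G)"
    and simple: "is_simple_epi (finite_algebra_category V) H G \<pi>"
  shows "covers (congruences V H) (Id_on (carrier H)) (hom_kernel H \<pi>)"
proof -
  let ?C = "finite_algebra_category V"
  have \<pi>: "\<pi> \<in> surj_homs V H G" and not_inj: "\<not> inj_on \<pi> (carrier H)"
    and interval: "quotient_interval ?C H (G, \<pi>)
      = {quotient_class ?C H (G, \<pi>), quotient_class ?C H (H, \<lambda>x \<in> carrier H. x)}"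
    using simple is_iso_iff[OF H(1)] by (auto simp: is_simple_epi_def is_epi_iff)
  have q: "(G, \<pi>) \<in> quotients ?C H" using \<pi> G by (simp add: in_quotients_iff)
  have Id_sub: "Id_on (carrier H) \<subseteq> hom_kernel H \<pi>" by (auto simp: hom_kernel_def)
  have "\<theta> = Id_on (carrier H) \<or> \<theta> = hom_kernel H \<pi>"
    if \<theta>: "\<theta> \<in> congruences V H" "\<theta> \<subseteq> hom_kernel H \<pi>" for \<theta>
  proof -
    obtain F \<rho> where F: "(F, \<rho>) \<in> quotients ?C H" and ker: "hom_kernel H \<rho> = \<theta>"
      using congruence_is_kernel[OF V H \<theta>(1)] .
    have "quotient_class ?C H (F, \<rho>) \<in> quotient_interval ?C H (G, \<pi>)"
      unfolding quotient_interval_def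
      using quotient_class_in_carrier[OF F] quotient_class_le_iff[OF H(1) q F] \<theta>(2) ker by blast
    then have "quotient_kernel H (quotient_class ?C H (F, \<rho>)) = hom_kernel H \<pi> \<or>
        quotient_kernel H (quotient_class ?C H (F, \<rho>)) = Id_on (carrier H)"
      unfolding interval
      using quotient_kernel_class[OF H(1) q] quotient_kernel_class[OF H(1) id_quotient[OF H]]
      by (auto simp: hom_kernel_id)
    then show ?thesis using quotient_kernel_class[OF H(1) F] ker by auto
  qed
  moreover have "hom_kernel H \<pi> \<noteq> Id_on (carrier H)"
    using not_inj hom_kernel_eq_Id_on_iff by blast
  ultimately show ?thesis
    unfolding covers_def
    using Id_on_congruence[OF H(1)] hom_kernel_congruence[OF H(1) \<pi>] Id_sub by (simp add: psubset_eq)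
qed

text \<open>
  The quotient that identifies all elements must be isomorphic to \<open>G\<close>.
\<close>

lemma minimal_card_le_1:
  assumes V: "is_variety V" and G: "is_minimal (finite_algebra_category V) G"
  shows "is_algebra V G" "finite (carrier G)" "card (carrier G) \<le> 1"
proof -
  show alg: "is_algebra V G" and fin: "finite (carrier G)"
    using G by (auto simp: is_minimal_def)
  obtain F \<pi> where F: "(F, \<pi>) \<in> quotients (finite_algebra_category V) G"
    and ker: "hom_kernel G \<pi> = carrier G \<times> carrier G"
    using congruence_is_kernel[OF V alg fin full_congruence[OF alg]] .
  have "quotient_class (finite_algebra_category V) G (F, \<pi>)
      = quotient_class (finite_algebra_category V) G (G, \<lambda>x \<in> carrier G. x)"
    using G quotient_class_in_carrier[OF F] by (auto simp: is_minimal_def)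
  then have "hom_kernel G \<pi> = Id_on (carrier G)"
    using quotient_kernel_class[OF alg F] quotient_kernel_class[OF alg id_quotient[OF alg fin]]
    by (simp add: hom_kernel_id)
  then have "x = y" if "x \<in> carrier G" "y \<in> carrier G" for x y
    using that unfolding ker by blast
  then show "card (carrier G) \<le> 1"
    using fin by (simp add: card_le_Suc0_iff_eq)
qed

section \<open>Invariants of a level\<close>

definition pullback :: "('a, 'f) alg \<Rightarrow> ('a \<Rightarrow> 'a) \<Rightarrow> 'a rel \<Rightarrow> 'a rel" where
  "pullback G \<pi> \<theta> = {(x, y). x \<in> carrier G \<and> y \<in> carrier G \<and> (\<pi> x, \<pi> y) \<in> \<theta>}"

lemma pullback_congruence:
  assumes G: "is_algebra V G" and \<pi>: "\<pi> \<in> surj_homs V G F" and \<theta>: "\<theta> \<in> congruences V F"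
  shows "pullback G \<pi> \<theta> \<in> congruences V G"
proof -
  have eq: "equiv (carrier F) \<theta>" using \<theta> by (rule congruence_equiv)
  then have "sym \<theta>" "trans \<theta>" and refl: "\<And>x. x \<in> carrier G \<Longrightarrow> (\<pi> x, \<pi> x) \<in> \<theta>"
    using surj_hom_in[OF \<pi>] by (auto simp: equiv_def refl_on_def)
  then have "sym (pullback G \<pi> \<theta>)" "trans (pullback G \<pi> \<theta>)"
    unfolding pullback_def by (auto intro!: symI transI dest: symD transD)
  moreover have "refl_on (carrier G) (pullback G \<pi> \<theta>)"
    using refl by (simp add: refl_on_def pullback_def)
  moreover have "pullback G \<pi> \<theta> \<subseteq> carrier G \<times> carrier G"
    by (auto simp: pullback_def)
  ultimately have "equiv (carrier G) (pullback G \<pi> \<theta>)" by (intro equivI)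
  moreover have "(oper G f xs, oper G f ys) \<in> pullback G \<pi> \<theta>"
    if f: "f \<in> symbols V" "length xs = arity V f"
      and xs: "list_all2 (\<lambda>x y. (x, y) \<in> pullback G \<pi> \<theta>) xs ys" for f xs ys
  proof -
    have carr: "length ys = arity V f" "set xs \<subseteq> carrier G" "set ys \<subseteq> carrier G"
      using xs f(2) by (auto simp: list_all2_conv_all_nth in_set_conv_nth pullback_def)
    have "list_all2 (\<lambda>x y. (x, y) \<in> \<theta>) (map \<pi> xs) (map \<pi> ys)"
      using xs by (auto simp: list_all2_conv_all_nth pullback_def)
    then have "(oper F f (map \<pi> xs), oper F f (map \<pi> ys)) \<in> \<theta>"
      using congruence_oper[OF \<theta> f(1)] f(2) by simp
    then show ?thesis
      using surj_homsD(3)[OF \<pi> f carr(2)] surj_homsD(3)[OF \<pi> f(1) carr(1,3)]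
        oper_closed[OF G f carr(2)] oper_closed[OF G f(1) carr(1,3)]
      by (simp add: pullback_def)
  qed
  ultimately show ?thesis by (simp add: congruences_def)
qed

text \<open>
  This and the next two lemmas are the correspondence theorem: pulling back is an order isomorphism
  from the congruences of \<open>F\<close> to those of \<open>G\<close> containing the kernel of \<open>\<pi>\<close>.
\<close>

lemma pullback_subset_iff:
  assumes \<pi>: "\<pi> \<in> surj_homs V G F" and \<theta>: "\<theta> \<in> congruences V F"
  shows "pullback G \<pi> \<theta> \<subseteq> pullback G \<pi> \<theta>' \<longleftrightarrow> \<theta> \<subseteq> \<theta>'"
proof
  assume sub: "pullback G \<pi> \<theta> \<subseteq> pullback G \<pi> \<theta>'"
  show "\<theta> \<subseteq> \<theta>'"
  proof (rule subrelI)
    fix x y assume xy: "(x, y) \<in> \<theta>"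
    then have "x \<in> carrier F" "y \<in> carrier F"
      using equiv_type[OF congruence_equiv[OF \<theta>]] by auto
    then obtain u w where "u \<in> carrier G" "w \<in> carrier G" "x = \<pi> u" "y = \<pi> w"
      using surj_homsD(2)[OF \<pi>] by blast
    then show "(x, y) \<in> \<theta>'" using sub xy by (auto simp: pullback_def)
  qed
qed (auto simp: pullback_def)

lemma hom_kernel_subset_pullback:
  assumes \<pi>: "\<pi> \<in> surj_homs V G F" and \<theta>: "\<theta> \<in> congruences V F"
  shows "hom_kernel G \<pi> \<subseteq> pullback G \<pi> \<theta>"
  using surj_hom_in[OF \<pi>] congruence_equiv[OF \<theta>]
  by (auto simp: pullback_def hom_kernel_def equiv_def refl_on_def)

lemma congruence_above_kernel_is_pullback:
  assumes G: "is_algebra V G" and \<pi>: "\<pi> \<in> surj_homs V G F"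
    and \<eta>: "\<eta> \<in> congruences V G" and above: "hom_kernel G \<pi> \<subseteq> \<eta>"
  obtains \<theta> where "\<theta> \<in> congruences V F" "pullback G \<pi> \<theta> = \<eta>"
proof -
  define \<theta> where "\<theta> = map_prod \<pi> \<pi> ` \<eta>"
  have eq: "equiv (carrier G) \<eta>" using \<eta> by (rule congruence_equiv)
  have field: "x \<in> carrier G \<and> y \<in> carrier G" if "(x, y) \<in> \<eta>" for x y
    using that equiv_type[OF eq] by blast
  have refl: "(x, x) \<in> \<eta>" if "x \<in> carrier G" for x
    using that eq by (simp add: equiv_def refl_on_def)
  have sym: "(y, x) \<in> \<eta>" if "(x, y) \<in> \<eta>" for x y
    using that eq unfolding equiv_def by (meson symD)
  have trans: "(x, z) \<in> \<eta>" if "(x, y) \<in> \<eta>" "(y, z) \<in> \<eta>" for x y z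
    using that eq unfolding equiv_def by (meson transD)
  have iff: "(\<pi> x, \<pi> y) \<in> \<theta> \<longleftrightarrow> (x, y) \<in> \<eta>" if xy: "x \<in> carrier G" "y \<in> carrier G" for x y
  proof
    assume "(\<pi> x, \<pi> y) \<in> \<theta>"
    then obtain u w where uw: "(u, w) \<in> \<eta>" "\<pi> x = \<pi> u" "\<pi> y = \<pi> w"
      by (auto simp: \<theta>_def)
    then have "(x, u) \<in> \<eta>" "(w, y) \<in> \<eta>"
      using above field[OF uw(1)] xy by (auto simp: hom_kernel_def)
    then show "(x, y) \<in> \<eta>" using trans[OF trans[OF _ uw(1)]] by blast
  qed (force simp: \<theta>_def)
  have lift: "\<exists>x \<in> carrier G. y = \<pi> x" if "y \<in> carrier F" for y
    using that surj_homsD(2)[OF \<pi>] by blast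
  have \<theta>_type: "\<theta> \<subseteq> carrier F \<times> carrier F"
    using field surj_hom_in[OF \<pi>] by (auto simp: \<theta>_def)
  have "equiv (carrier F) \<theta>"
  proof (rule equivI[OF \<theta>_type])
    show "refl_on (carrier F) \<theta>"
      using lift iff refl by (metis refl_onI)
    show "sym \<theta>"
      using sym by (auto simp: sym_def \<theta>_def)
    show "trans \<theta>"
    proof (rule transI)
      fix x y z assume xyz: "(x, y) \<in> \<theta>" "(y, z) \<in> \<theta>"
      then have "x \<in> carrier F" "y \<in> carrier F" "z \<in> carrier F" using \<theta>_type by auto
      then obtain u v w where "u \<in> carrier G" "x = \<pi> u" "v \<in> carrier G" "y = \<pi> v"
        "w \<in> carrier G" "z = \<pi> w"
        using lift by meson
      then show "(x, z) \<in> \<theta>" using xyz iff trans by meson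
    qed
  qed
  moreover have "(oper F f xs, oper F f ys) \<in> \<theta>"
    if f: "f \<in> symbols V" "length xs = arity V f"
      and xs: "list_all2 (\<lambda>x y. (x, y) \<in> \<theta>) xs ys" for f xs ys
  proof -
    have len: "length ys = length xs" using xs by (simp add: list_all2_lengthD)
    have "list_all2 (\<lambda>x y. x \<in> carrier F \<and> y \<in> carrier F) xs ys"
      using xs by (rule list_all2_mono) (use \<theta>_type in auto)
    then have "set xs \<subseteq> \<pi> ` carrier G" "set ys \<subseteq> \<pi> ` carrier G"
      unfolding surj_homsD(2)[OF \<pi>]
      by (auto simp: list_all2_conv_all_nth in_set_conv_nth)
    then obtain us ws where us: "set us \<subseteq> carrier G" "xs = map \<pi> us"
      and ws: "set ws \<subseteq> carrier G" "ys = map \<pi> ws"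
      by (metis lift_list)
    have "list_all2 (\<lambda>x y. (x, y) \<in> \<eta>) us ws"
      using xs us ws by (auto simp: list_all2_conv_all_nth iff[symmetric] subset_iff)
    then have "(oper G f us, oper G f ws) \<in> \<eta>"
      using congruence_oper[OF \<eta> f(1)] f(2) us(2) by simp
    then have "(\<pi> (oper G f us), \<pi> (oper G f ws)) \<in> \<theta>" using iff field by blast
    then show ?thesis
      using surj_homsD(3)[OF \<pi> f(1) _ us(1)] surj_homsD(3)[OF \<pi> f(1) _ ws(1)] f(2) len us(2) ws(2)
      by simp
  qed
  ultimately have "\<theta> \<in> congruences V F" by (simp add: congruences_def)
  moreover have "pullback G \<pi> \<theta> = \<eta>"
    using iff field by (auto simp: pullback_def)
  ultimately show ?thesis by (rule that)
qed

lemma covers_pullback_iff: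
  assumes G: "is_algebra V G" and \<pi>: "\<pi> \<in> surj_homs V G F"
    and \<eta>: "\<eta> \<in> congruences V F" and \<gamma>: "\<gamma> \<in> congruences V F"
  shows "covers (congruences V G) (pullback G \<pi> \<eta>) (pullback G \<pi> \<gamma>) \<longleftrightarrow> covers (congruences V F) \<eta> \<gamma>"
proof -
  note sub = pullback_subset_iff[OF \<pi>]
  have eq: "pullback G \<pi> \<theta> = pullback G \<pi> \<theta>' \<longleftrightarrow> \<theta> = \<theta>'"
    if "\<theta> \<in> congruences V F" "\<theta>' \<in> congruences V F" for \<theta> \<theta>'
    using sub[OF that(1)] sub[OF that(2)] by (metis order_antisym order_refl)
  have "(\<forall>\<theta> \<in> congruences V G. pullback G \<pi> \<eta> \<subseteq> \<theta> \<longrightarrow> \<theta> \<subseteq> pullback G \<pi> \<gamma> \<longrightarrow>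
        \<theta> = pullback G \<pi> \<eta> \<or> \<theta> = pullback G \<pi> \<gamma>) \<longleftrightarrow>
      (\<forall>\<theta> \<in> congruences V F. \<eta> \<subseteq> \<theta> \<longrightarrow> \<theta> \<subseteq> \<gamma> \<longrightarrow> \<theta> = \<eta> \<or> \<theta> = \<gamma>)" (is "?L \<longleftrightarrow> ?R")
  proof
    assume L: ?L
    show ?R
    proof (intro ballI impI)
      fix \<theta> assume \<theta>: "\<theta> \<in> congruences V F" "\<eta> \<subseteq> \<theta>" "\<theta> \<subseteq> \<gamma>"
      then show "\<theta> = \<eta> \<or> \<theta> = \<gamma>"
        using L pullback_congruence[OF G \<pi> \<theta>(1)] sub[OF \<eta>, of \<theta>] sub[OF \<theta>(1), of \<gamma>]
          eq[OF \<theta>(1) \<eta>] eq[OF \<theta>(1) \<gamma>]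
        by blast
    qed
  next
    assume R: ?R
    show ?L
    proof (intro ballI impI)
      fix \<theta> assume \<theta>: "\<theta> \<in> congruences V G" "pullback G \<pi> \<eta> \<subseteq> \<theta>" "\<theta> \<subseteq> pullback G \<pi> \<gamma>"
      have "hom_kernel G \<pi> \<subseteq> \<theta>"
        using hom_kernel_subset_pullback[OF \<pi> \<eta>] \<theta>(2) by simp
      then obtain \<theta>' where \<theta>': "\<theta>' \<in> congruences V F" "pullback G \<pi> \<theta>' = \<theta>"
        using congruence_above_kernel_is_pullback[OF G \<pi> \<theta>(1)] by blast
      then have "\<eta> \<subseteq> \<theta>'" "\<theta>' \<subseteq> \<gamma>"
        using sub[OF \<eta>, of \<theta>'] sub[OF \<theta>'(1), of \<gamma>] \<theta> by simp_all
      then show "\<theta> = pullback G \<pi> \<eta> \<or> \<theta> = pullback G \<pi> \<gamma>" using R \<theta>' by blast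
    qed
  qed
  then show ?thesis
    unfolding covers_def psubset_eq
    using pullback_congruence[OF G \<pi>] sub[OF \<eta>] eq[OF \<eta> \<gamma>] \<eta> \<gamma> by simp
qed

text \<open>
  The map \<open>\<pi>\<close> sends pulled-back classes onto classes, and distinct ones to distinct ones.
\<close>

lemma class_index_pullback:
  assumes \<pi>: "\<pi> \<in> surj_homs V G F"
    and \<eta>: "\<eta> \<in> congruences V F" and \<gamma>: "\<gamma> \<in> congruences V F" and x: "x \<in> carrier G"
  shows "card ((pullback G \<pi> \<gamma> `` {x}) // pullback G \<pi> \<eta>) = card ((\<gamma> `` {\<pi> x}) // \<eta>)"
proof -
  let ?\<eta> = "pullback G \<pi> \<eta>" and ?\<gamma> = "pullback G \<pi> \<gamma>"
  have img: "\<pi> ` (pullback G \<pi> \<theta> `` {y}) = \<theta> `` {\<pi> y}"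
    if \<theta>: "\<theta> \<in> congruences V F" and y: "y \<in> carrier G" for \<theta> y
  proof
    show "\<theta> `` {\<pi> y} \<subseteq> \<pi> ` (pullback G \<pi> \<theta> `` {y})"
    proof
      fix z assume z: "z \<in> \<theta> `` {\<pi> y}"
      then have "z \<in> carrier F" using equiv_type[OF congruence_equiv[OF \<theta>]] by blast
      then obtain w where w: "w \<in> carrier G" "z = \<pi> w" using surj_homsD(2)[OF \<pi>] by blast
      then have "w \<in> pullback G \<pi> \<theta> `` {y}" using y z by (simp add: pullback_def)
      then show "z \<in> \<pi> ` (pullback G \<pi> \<theta> `` {y})" using w(2) by blast
    qed
  qed (auto simp: pullback_def)
  have lower: "(\<gamma> `` {\<pi> x}) // \<eta> = (\<lambda>z. \<eta> `` {z}) ` (\<gamma> `` {\<pi> x})"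
    and upper: "(?\<gamma> `` {x}) // ?\<eta> = (\<lambda>y. ?\<eta> `` {y}) ` (?\<gamma> `` {x})"
    by (auto simp: quotient_def)
  have carr: "y \<in> carrier G" if "y \<in> ?\<gamma> `` {x}" for y
    using that by (simp add: pullback_def)
  have "(image \<pi>) ` ((?\<gamma> `` {x}) // ?\<eta>) = (\<lambda>y. \<eta> `` {\<pi> y}) ` (?\<gamma> `` {x})"
    unfolding upper image_image using img[OF \<eta> carr] by (rule image_cong[OF refl])
  also have "\<dots> = (\<lambda>z. \<eta> `` {z}) ` (\<pi> ` (?\<gamma> `` {x}))"
    by (simp add: image_image)
  also have "\<dots> = (\<gamma> `` {\<pi> x}) // \<eta>"
    unfolding img[OF \<gamma> x] lower ..
  finally have onto: "(image \<pi>) ` ((?\<gamma> `` {x}) // ?\<eta>) = (\<gamma> `` {\<pi> x}) // \<eta>" .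
  have "inj_on (image \<pi>) ((?\<gamma> `` {x}) // ?\<eta>)"
    unfolding upper
  proof (rule inj_onI, clarify)
    fix y z assume "(x, y) \<in> ?\<gamma>" "(x, z) \<in> ?\<gamma>" and eq: "\<pi> ` (?\<eta> `` {y}) = \<pi> ` (?\<eta> `` {z})"
    then have yz: "y \<in> carrier G" "z \<in> carrier G" by (auto simp: pullback_def)
    then have "\<eta> `` {\<pi> y} = \<eta> `` {\<pi> z}" using eq img[OF \<eta>] by metis
    then show "?\<eta> `` {y} = ?\<eta> `` {z}"
      using yz by (auto simp: pullback_def Image_def)
  qed
  then show ?thesis using onto card_image by metis
qed

definition symbols_agree :: "'f presentation \<Rightarrow> ('a, 'f) alg set \<Rightarrow> 'f \<Rightarrow> 'f \<Rightarrow> bool" where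
  "symbols_agree V B f g \<longleftrightarrow> f \<in> symbols V \<and> g \<in> symbols V \<and> arity V f = arity V g \<and>
    (\<forall>b \<in> B. oper b f = oper b g)"

text \<open>
  The symbols that agree on \<open>B\<close> become equal in the quotient of \<open>G\<close> by \<open>\<kappa>\<close>.
\<close>

definition symbols_identified ::
  "'f presentation \<Rightarrow> ('a, 'f) alg set \<Rightarrow> ('a, 'f) alg \<Rightarrow> 'a rel \<Rightarrow> bool" where
  "symbols_identified V B G \<kappa> \<longleftrightarrow> (\<forall>f g xs. symbols_agree V B f g \<longrightarrow> length xs = arity V f \<longrightarrow>
    set xs \<subseteq> carrier G \<longrightarrow> (oper G f xs, oper G g xs) \<in> \<kappa>)"

lemma symbols_identified_kernel_iff:
  assumes G: "is_algebra V G" and F: "is_algebra V F" and \<pi>: "\<pi> \<in> surj_homs V G F"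
  shows "symbols_identified V B G (hom_kernel G \<pi>) \<longleftrightarrow> symbols_identified V B F (Id_on (carrier F))"
proof
  assume G_id: "symbols_identified V B G (hom_kernel G \<pi>)"
  show "symbols_identified V B F (Id_on (carrier F))"
    unfolding symbols_identified_def
  proof (intro allI impI)
    fix f g ys assume fg: "symbols_agree V B f g" and ys: "length ys = arity V f" "set ys \<subseteq> carrier F"
    then have f: "f \<in> symbols V" and g: "g \<in> symbols V" "length ys = arity V g"
      by (auto simp: symbols_agree_def)
    obtain xs where xs: "set xs \<subseteq> carrier G" "ys = map \<pi> xs" "length xs = length ys"
      using lift_list ys(2) unfolding surj_homsD(2)[OF \<pi>, symmetric] by metis
    then have "(oper G f xs, oper G g xs) \<in> hom_kernel G \<pi>"
      using G_id fg ys(1) unfolding symbols_identified_def by metis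
    then have "\<pi> (oper G f xs) = \<pi> (oper G g xs)" by (simp add: hom_kernel_def)
    moreover have "length xs = arity V f" "length xs = arity V g" using xs(3) ys(1) g(2) by simp_all
    ultimately have "oper F f ys = oper F g ys"
      unfolding xs(2) using surj_homsD(3)[OF \<pi> f _ xs(1)] surj_homsD(3)[OF \<pi> g(1) _ xs(1)] by metis
    then show "(oper F f ys, oper F g ys) \<in> Id_on (carrier F)"
      using oper_closed[OF F f ys] by auto
  qed
next
  assume F_id: "symbols_identified V B F (Id_on (carrier F))"
  show "symbols_identified V B G (hom_kernel G \<pi>)"
    unfolding symbols_identified_def
  proof (intro allI impI)
    fix f g xs assume fg: "symbols_agree V B f g" and xs: "length xs = arity V f" "set xs \<subseteq> carrier G"
    then have f: "f \<in> symbols V" and g: "g \<in> symbols V" "length xs = arity V g"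
      by (auto simp: symbols_agree_def)
    have "set (map \<pi> xs) \<subseteq> carrier F" "length (map \<pi> xs) = arity V f"
      using xs surj_hom_in[OF \<pi>] by auto
    then have "(oper F f (map \<pi> xs), oper F g (map \<pi> xs)) \<in> Id_on (carrier F)"
      using F_id fg unfolding symbols_identified_def by blast
    then have "\<pi> (oper G f xs) = \<pi> (oper G g xs)"
      using surj_homsD(3)[OF \<pi> f xs] surj_homsD(3)[OF \<pi> g xs(2)] by auto
    then show "(oper G f xs, oper G g xs) \<in> hom_kernel G \<pi>"
      using oper_closed[OF G f xs] oper_closed[OF G g xs(2)] by (simp add: hom_kernel_def)
  qed
qed

lemma symbols_identified_card_le_1:
  assumes G: "is_algebra V G" "finite (carrier G)" "card (carrier G) \<le> 1"
  shows "symbols_identified V B G (Id_on (carrier G))"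
  unfolding symbols_identified_def
proof (intro allI impI)
  fix f g xs assume "symbols_agree V B f g" "length xs = arity V f" "set xs \<subseteq> carrier G"
  then have "oper G f xs \<in> carrier G" "oper G g xs \<in> carrier G"
    using oper_closed[OF G(1)] by (simp_all add: symbols_agree_def)
  then show "(oper G f xs, oper G g xs) \<in> Id_on (carrier G)"
    using G(2,3) by (auto simp: card_le_Suc0_iff_eq)
qed

lemma cover_index_bounded_kernel_iff:
  assumes G: "is_algebra V G" and \<pi>: "\<pi> \<in> surj_homs V G F"
  shows "cover_index_bounded (carrier G) (congruences V G) N (hom_kernel G \<pi>) \<longleftrightarrow>
    cover_index_bounded (carrier F) (congruences V F) N (Id_on (carrier F))"
proof
  assume G_bound: "cover_index_bounded (carrier G) (congruences V G) N (hom_kernel G \<pi>)"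
  show "cover_index_bounded (carrier F) (congruences V F) N (Id_on (carrier F))"
    unfolding cover_index_bounded_def
  proof (intro allI impI ballI)
    fix \<eta> \<gamma> y assume cov: "covers (congruences V F) \<eta> \<gamma>" and "y \<in> carrier F"
    then obtain x where x: "x \<in> carrier G" "y = \<pi> x" using surj_homsD(2)[OF \<pi>] by blast
    have \<eta>: "\<eta> \<in> congruences V F" and \<gamma>: "\<gamma> \<in> congruences V F"
      using cov by (simp_all add: covers_def)
    have "card ((pullback G \<pi> \<gamma> `` {x}) // pullback G \<pi> \<eta>) \<le> N"
      using G_bound covers_pullback_iff[OF G \<pi> \<eta> \<gamma>] cov hom_kernel_subset_pullback[OF \<pi> \<eta>] x(1)
      unfolding cover_index_bounded_def by blast
    then show "card ((\<gamma> `` {y}) // \<eta>) \<le> N"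
      using class_index_pullback[OF \<pi> \<eta> \<gamma> x(1)] x(2) by simp
  qed
next
  assume F_bound: "cover_index_bounded (carrier F) (congruences V F) N (Id_on (carrier F))"
  show "cover_index_bounded (carrier G) (congruences V G) N (hom_kernel G \<pi>)"
    unfolding cover_index_bounded_def
  proof (intro allI impI ballI)
    fix \<eta> \<gamma> x assume cov: "covers (congruences V G) \<eta> \<gamma>" and above: "hom_kernel G \<pi> \<subseteq> \<eta>"
      and x: "x \<in> carrier G"
    have \<eta>: "\<eta> \<in> congruences V G" and \<gamma>: "\<gamma> \<in> congruences V G" and "\<eta> \<subseteq> \<gamma>"
      using cov by (auto simp: covers_def)
    obtain \<eta>' where \<eta>': "\<eta>' \<in> congruences V F" "pullback G \<pi> \<eta>' = \<eta>"
      using congruence_above_kernel_is_pullback[OF G \<pi> \<eta> above] .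
    obtain \<gamma>' where \<gamma>': "\<gamma>' \<in> congruences V F" "pullback G \<pi> \<gamma>' = \<gamma>"
      using congruence_above_kernel_is_pullback[OF G \<pi> \<gamma>] above \<open>\<eta> \<subseteq> \<gamma>\<close> by blast
    have "covers (congruences V F) \<eta>' \<gamma>'"
      using covers_pullback_iff[OF G \<pi> \<eta>'(1) \<gamma>'(1)] cov \<eta>'(2) \<gamma>'(2) by simp
    moreover have "Id_on (carrier F) \<subseteq> \<eta>'"
      using congruence_equiv[OF \<eta>'(1)] by (auto simp: equiv_def refl_on_def)
    ultimately have "card ((\<gamma>' `` {\<pi> x}) // \<eta>') \<le> N"
      using F_bound surj_hom_in[OF \<pi> x] unfolding cover_index_bounded_def by blast
    then show "card ((\<gamma> `` {x}) // \<eta>) \<le> N"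
      using class_index_pullback[OF \<pi> \<eta>'(1) \<gamma>'(1) x] \<eta>'(2) \<gamma>'(2) by simp
  qed
qed

text \<open>
  Both properties concern the quotient of \<open>G\<close> by \<open>\<kappa>\<close>; the algebra \<open>G\<close> itself is the case of the identity
  relation.
\<close>

definition level_invariant ::
  "'f presentation \<Rightarrow> ('a, 'f) alg set \<Rightarrow> nat \<Rightarrow> ('a, 'f) alg \<Rightarrow> 'a rel \<Rightarrow> bool" where
  "level_invariant V B N G \<kappa> \<longleftrightarrow>
    cover_index_bounded (carrier G) (congruences V G) N \<kappa> \<and> symbols_identified V B G \<kappa>"

text \<open>
  The invariant does not depend on the algebra from which a quotient is formed.  This allows the
  invariants of two quotients to be compared over a common source.
\<close>

lemma level_invariant_kernel_iff:
  assumes "is_algebra V G" "is_algebra V F" "\<pi> \<in> surj_homs V G F"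
  shows "level_invariant V B N G (hom_kernel G \<pi>) \<longleftrightarrow> level_invariant V B N F (Id_on (carrier F))"
  using symbols_identified_kernel_iff[OF assms] cover_index_bounded_kernel_iff[OF assms(1,3)]
  unfolding level_invariant_def by blast

lemma level_invariant_quotient:
  assumes G: "is_algebra V G" and F: "is_algebra V F" and \<pi>: "\<pi> \<in> surj_homs V G F"
    and inv: "level_invariant V B N G (Id_on (carrier G))"
  shows "level_invariant V B N F (Id_on (carrier F))"
proof -
  have "Id_on (carrier G) \<subseteq> hom_kernel G \<pi>" by (auto simp: hom_kernel_def)
  moreover have "cover_index_bounded (carrier G) (congruences V G) N (Id_on (carrier G))"
    and "symbols_identified V B G (Id_on (carrier G))"
    using inv by (simp_all add: level_invariant_def)
  ultimately have "cover_index_bounded (carrier G) (congruences V G) N (hom_kernel G \<pi>)"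
    and "symbols_identified V B G (hom_kernel G \<pi>)"
    by (auto simp: symbols_identified_def intro: cover_index_bounded_mono)
  then have "level_invariant V B N G (hom_kernel G \<pi>)"
    by (simp add: level_invariant_def)
  then show ?thesis using level_invariant_kernel_iff[OF G F \<pi>] by blast
qed

lemma level_invariant_inter:
  assumes V: "malcev_variety V" and G: "is_algebra V G"
    and \<kappa>: "\<kappa> \<in> congruences V G" "\<kappa>' \<in> congruences V G"
    and inv: "level_invariant V B N G \<kappa>" "level_invariant V B N G \<kappa>'"
  shows "level_invariant V B N G (\<kappa> \<inter> \<kappa>')"
  using permuting_equivalences.cover_index_bounded_inter[OF congruences_permuting_equivalences[OF V G] \<kappa>]
    inv
  unfolding level_invariant_def symbols_identified_def by simp

text \<open>
  The intersection of the kernels is itself the kernel of some quotient, and that one is then the least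
  upper bound.
\<close>

lemma kernel_of_join:
  assumes V: "is_variety V" and G: "is_algebra V G" "finite (carrier G)"
    and H: "(H, \<psi>) \<in> quotients (finite_algebra_category V) G"
    and F: "(F, \<pi>) \<in> quotients (finite_algebra_category V) G"
    and J: "(J, \<rho>) \<in> quotients (finite_algebra_category V) G"
    and lub: "is_lub (quotient_poset (finite_algebra_category V) G)
      (quotient_class (finite_algebra_category V) G (J, \<rho>))
      {quotient_class (finite_algebra_category V) G (H, \<psi>),
       quotient_class (finite_algebra_category V) G (F, \<pi>)}"
  shows "hom_kernel G \<rho> = hom_kernel G \<psi> \<inter> hom_kernel G \<pi>"
proof -
  let ?C = "finite_algebra_category V" and ?P = "quotient_poset (finite_algebra_category V) G"
  note le = quotient_class_le_iff[OF G(1)]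
  have cl: "quotient_class ?C G (X, \<xi>) \<in> carrier ?P" if "(X, \<xi>) \<in> quotients ?C G" for X \<xi>
    using that by (rule quotient_class_in_carrier)
  have upper: "quotient_class ?C G (J, \<rho>) \<in> Upper ?P {quotient_class ?C G (H, \<psi>), quotient_class ?C G (F, \<pi>)}"
    using lub unfolding least_def by blast
  have sub: "hom_kernel G \<rho> \<subseteq> hom_kernel G \<psi> \<inter> hom_kernel G \<pi>"
    using upper le[OF H J] le[OF F J] cl[OF H] cl[OF F] unfolding Upper_def by blast
  have "hom_kernel G \<psi> \<inter> hom_kernel G \<pi> \<in> congruences V G"
    using H F congruence_inter hom_kernel_congruence[OF G(1)] unfolding in_quotients_iff by blast
  then obtain D \<delta> where D: "(D, \<delta>) \<in> quotients ?C G"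
    and ker: "hom_kernel G \<delta> = hom_kernel G \<psi> \<inter> hom_kernel G \<pi>"
    using congruence_is_kernel[OF V G] by blast
  have "quotient_class ?C G (D, \<delta>) \<in> Upper ?P {quotient_class ?C G (H, \<psi>), quotient_class ?C G (F, \<pi>)}"
    using le[OF H D] le[OF F D] ker cl[OF D] unfolding Upper_def by auto
  then have "quotient_class ?C G (J, \<rho>) \<sqsubseteq>\<^bsub>?P\<^esub> quotient_class ?C G (D, \<delta>)"
    using lub unfolding least_def by blast
  then show ?thesis using le[OF J D] ker sub by blast
qed

text \<open>
  The algebras with the invariant form a class that is closed under isomorphisms, quotients and joins.
  It contains \<open>B\<close> because a class cannot split into more parts than the algebra has elements; it
  contains the minimal objects because they have at most one element.
\<close>

lemma generated_level_invariant:
  fixes B :: "('a, 'f) alg set"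
  assumes V: "malcev_variety V"
    and B: "\<And>b. b \<in> B \<Longrightarrow> is_algebra V b \<and> finite (carrier b) \<and> card (carrier b) \<le> N"
    and N: "1 \<le> N" and H: "H \<in> generated_level (finite_algebra_category V) B"
  shows "is_algebra V H" "finite (carrier H)" "level_invariant V B N H (Id_on (carrier H))"
proof -
  let ?C = "finite_algebra_category V"
  define S where "S = {A :: ('a, 'f) alg. is_algebra V A \<and> finite (carrier A) \<and>
    level_invariant V B N A (Id_on (carrier A))}"
  have var: "is_variety V" using V by (simp add: malcev_variety_def)
  have bound_small: "cover_index_bounded (carrier A) (congruences V A) N \<kappa>"
    if A: "finite (carrier A)" "card (carrier A) \<le> N" for A :: "('a, 'f) alg" and \<kappa>
    unfolding cover_index_bounded_def
  proof (intro allI impI ballI)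
    fix \<eta> \<gamma> x assume cov: "covers (congruences V A) \<eta> \<gamma>"
    then have "\<gamma> `` {x} \<subseteq> carrier A"
      using equiv_type[OF congruence_equiv[of \<gamma> V A]] by (auto simp: covers_def)
    then have fin: "finite (\<gamma> `` {x})" and "card (\<gamma> `` {x}) \<le> N"
      using A finite_subset card_mono le_trans by metis+
    moreover have "(\<gamma> `` {x}) // \<eta> = (\<lambda>y. \<eta> `` {y}) ` (\<gamma> `` {x})"
      by (auto simp: quotient_def)
    ultimately show "card ((\<gamma> `` {x}) // \<eta>) \<le> N"
      using card_image_le[OF fin] le_trans by metis
  qed
  have down: "F \<in> S" if "A \<in> S" "is_algebra V F" "finite (carrier F)" "\<pi> \<in> surj_homs V A F" for A F \<pi>
    using that level_invariant_quotient unfolding S_def by blast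
  have "iso_closed ?C S"
    unfolding iso_closed_def
  proof (intro conjI ballI subsetI)
    fix A F assume A: "A \<in> S" and F: "F \<in> iso_class ?C A"
    then obtain f where "is_iso ?C A F f" by (auto simp: iso_class_def isomorphic_def)
    then have "f \<in> surj_homs V A F" by (simp add: is_iso_def)
    then show "F \<in> S" using down[OF A] F by (simp add: iso_class_def)
  qed (simp add: S_def)
  moreover have "downward_closed ?C S"
    unfolding downward_closed_def using down by (auto simp: in_quotients_iff)
  moreover have "join_closed ?C S"
    unfolding join_closed_def
  proof (clarify)
    fix G H \<psi> F \<pi> J \<rho>
    assume "G \<in> Obj ?C"
      and q: "(H, \<psi>) \<in> quotients ?C G" "(F, \<pi>) \<in> quotients ?C G" "(J, \<rho>) \<in> quotients ?C G"
      and S: "H \<in> S" "F \<in> S"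
      and lub: "is_lub (quotient_poset ?C G) (quotient_class ?C G (J, \<rho>))
        {quotient_class ?C G (H, \<psi>), quotient_class ?C G (F, \<pi>)}"
    then have G: "is_algebra V G" "finite (carrier G)" by simp_all
    have homs: "\<psi> \<in> surj_homs V G H" "\<pi> \<in> surj_homs V G F" "\<rho> \<in> surj_homs V G J"
      and algs: "is_algebra V H" "is_algebra V F" "is_algebra V J" "finite (carrier J)"
      using q by (simp_all add: in_quotients_iff)
    have "level_invariant V B N G (hom_kernel G \<psi>)" "level_invariant V B N G (hom_kernel G \<pi>)"
      using S level_invariant_kernel_iff[OF G(1) algs(1) homs(1)]
        level_invariant_kernel_iff[OF G(1) algs(2) homs(2)] unfolding S_def by blast+
    then have "level_invariant V B N G (hom_kernel G \<rho>)"
      unfolding kernel_of_join[OF var G q lub]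
      using level_invariant_inter[OF V G(1)] hom_kernel_congruence[OF G(1)] homs by blast
    then show "J \<in> S"
      using level_invariant_kernel_iff[OF G(1) algs(3) homs(3)] algs unfolding S_def by blast
  qed
  moreover have "B \<subseteq> S"
  proof
    fix b assume b: "b \<in> B"
    have "symbols_identified V B b (Id_on (carrier b))"
      unfolding symbols_identified_def symbols_agree_def
      using b B oper_closed[of V b] by auto
    then show "b \<in> S" using B[OF b] bound_small by (simp add: S_def level_invariant_def)
  qed
  moreover have "{G. is_minimal ?C G} \<subseteq> S"
  proof clarify
    fix G :: "('a, 'f) alg" assume "is_minimal ?C G"
    then have G: "is_algebra V G" "finite (carrier G)" "card (carrier G) \<le> 1"
      using minimal_card_le_1[OF var] by blast+
    then show "G \<in> S" using symbols_identified_card_le_1[OF G] bound_small[OF G(2)] N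
      by (simp add: S_def level_invariant_def)
  qed
  ultimately have "H \<in> S" using H unfolding generated_level_def by blast
  then show "is_algebra V H" "finite (carrier H)" "level_invariant V B N H (Id_on (carrier H))"
    by (simp_all add: S_def)
qed


section \<open>Finiteness of the set of algebras with few essentially different operations\<close>

definition operations :: "nat \<Rightarrow> 'a set \<Rightarrow> ('a list \<Rightarrow> 'a) set" where
  "operations n X = {u. \<forall>xs. if length xs = n \<and> set xs \<subseteq> X then u xs \<in> X else u xs = undefined}"

lemma finite_operations: "finite X \<Longrightarrow> finite (operations n X)"
proof -
  assume X: "finite X"
  have "operations n X = {xs. set xs \<subseteq> X \<and> length xs = n} \<rightarrow>\<^sub>E X"
    by (auto simp: operations_def PiE_def extensional_def Pi_def split: if_splits)
  then show ?thesis using X by (simp add: finite_PiE finite_lists_length_eq)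
qed

lemma oper_in_operations:
  assumes "is_algebra V A" "f \<in> symbols V"
  shows "oper A f \<in> operations (arity V f) (carrier A)"
  using assms unfolding operations_def is_algebra_def by simp

text \<open>
  The arity of a symbol and its interpretations in the members of \<open>B\<close> form its signature, and there are
  finitely many signatures.  An algebra that identifies symbols agreeing on \<open>B\<close> is determined by the operation that it
  assigns to each signature.
\<close>

lemma finite_algebras_on:
  fixes V :: "'f presentation" and B :: "('a, 'f) alg set"
  assumes finite_arity: "finite (arity V ` symbols V)"
    and B: "finite B" "\<And>b. b \<in> B \<Longrightarrow> is_algebra V b \<and> finite (carrier b)"
    and U: "finite (U :: 'a set)"
  shows "finite {A :: ('a, 'f) alg. carrier A = U \<and> is_algebra V A \<and>
    symbols_identified V B A (Id_on (carrier A))}" (is "finite ?\<A>")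
proof -
  define sig where "sig f = (arity V f, \<lambda>b \<in> B. oper b f)" for f
  \<comment> \<open>The choice of a symbol for each signature is harmless by \<open>oper_code\<close> below.\<close>
  define code where "code A = (\<lambda>s \<in> sig ` symbols V. oper A (SOME f. f \<in> symbols V \<and> sig f = s))"
    for A :: "('a, 'f) alg"
  have "sig ` symbols V \<subseteq> (SIGMA n : arity V ` symbols V. PiE B (\<lambda>b. operations n (carrier b)))"
    using oper_in_operations B by (fastforce simp: sig_def)
  moreover have "finite \<dots>"
    using finite_arity B finite_operations by (intro finite_SigmaI finite_PiE) auto
  ultimately have fin_sig: "finite (sig ` symbols V)" by (rule finite_subset)
  have rep: "(SOME g. g \<in> symbols V \<and> sig g = sig f) \<in> symbols V \<and>
      sig (SOME g. g \<in> symbols V \<and> sig g = sig f) = sig f" if "f \<in> symbols V" for f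
    using that by (intro someI[of "\<lambda>g. g \<in> symbols V \<and> sig g = sig f"]) simp
  have oper_code: "oper A f = code A (sig f)" if A: "A \<in> ?\<A>" and f: "f \<in> symbols V" for A f
  proof -
    define g where "g = (SOME g. g \<in> symbols V \<and> sig g = sig f)"
    have g: "g \<in> symbols V" "sig g = sig f" using rep[OF f] by (simp_all add: g_def)
    have arity: "arity V g = arity V f" using g(2) by (simp add: sig_def)
    have "oper b f = oper b g" if "b \<in> B" for b
    proof -
      have "(\<lambda>b \<in> B. oper b g) b = (\<lambda>b \<in> B. oper b f) b" using g(2) by (simp add: sig_def)
      then show ?thesis using that by simp
    qed
    then have agree: "symbols_agree V B f g" using f g(1) arity by (simp add: symbols_agree_def)
    have alg: "is_algebra V A" and ident: "symbols_identified V B A (Id_on (carrier A))"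
      using A by blast+
    have "oper A f = oper A g"
    proof
      fix xs
      show "oper A f xs = oper A g xs"
      proof (cases "length xs = arity V f \<and> set xs \<subseteq> carrier A")
        case True
        then have "(oper A f xs, oper A g xs) \<in> Id_on (carrier A)"
          using ident agree unfolding symbols_identified_def by blast
        then show ?thesis by (simp add: Id_on_iff)
      next
        case False
        then show ?thesis using oper_undefined[OF alg, of f xs] oper_undefined[OF alg, of g xs] arity
          by auto
      qed
    qed
    then show ?thesis using f by (simp add: code_def g_def)
  qed
  have "inj_on code ?\<A>"
  proof (rule inj_onI)
    fix A A' assume A: "A \<in> ?\<A>" and A': "A' \<in> ?\<A>" and eq: "code A = code A'"
    have "oper A f = oper A' f" for f
    proof (cases "f \<in> symbols V")
      case True
      then show ?thesis using oper_code[OF A] oper_code[OF A'] eq by simp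
    next
      case False
      then show ?thesis using A A' by (auto simp: oper_undefined)
    qed
    then have "oper A = oper A'" by blast
    moreover have "carrier A = carrier A'" using A A' by simp
    ultimately show "A = A'" by (intro alg.equality) simp_all
  qed
  moreover have "code ` ?\<A> \<subseteq> PiE (sig ` symbols V) (\<lambda>s. operations (fst s) U)"
  proof (rule image_subsetI)
    fix A :: "('a, 'f) alg" assume A: "A \<in> ?\<A>"
    have "code A (sig f) \<in> operations (fst (sig f)) U" if f: "f \<in> symbols V" for f
      using oper_in_operations[of V A f] A f oper_code[OF A f] by (simp add: sig_def)
    then show "code A \<in> PiE (sig ` symbols V) (\<lambda>s. operations (fst s) U)"
      by (auto simp: code_def)
  qed
  moreover have "finite (PiE (sig ` symbols V) (\<lambda>s. operations (fst s) U))"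
    using fin_sig finite_operations[OF U] by (simp add: finite_PiE)
  ultimately show ?thesis by (rule inj_on_finite)
qed

lemma isomorphic_copy:
  fixes A :: "('a, 'f) alg"
  assumes V: "is_variety V" and A: "is_algebra V A" "finite (carrier A)"
    and U: "finite (U :: 'a set)" "card U = card (carrier A)"
  obtains A' :: "('a, 'f) alg" and h where "is_algebra V A'" "carrier A' = U"
    "is_iso (finite_algebra_category V) A A' h"
proof -
  obtain h where h: "bij_betw h (carrier A) U"
    using finite_same_card_bij[OF A(2) U(1)] U(2) by auto
  then have inj: "inj_on h (carrier A)" and img: "h ` carrier A = U"
    by (simp_all add: bij_betw_def)
  have cong: "hom_kernel A h \<in> congruences V A"
    using inj hom_kernel_eq_Id_on_iff[of A h] Id_on_congruence[OF A(1)] by simp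
  show ?thesis
  proof (rule that)
    show "is_algebra V (image_algebra V A h)"
      by (rule image_algebra_is_algebra[OF V A(1) cong])
    show "carrier (image_algebra V A h) = U"
      by (simp add: carrier_image_algebra img)
    show "is_iso (finite_algebra_category V) A (image_algebra V A h) (restrict h (carrier A))"
      using is_iso_iff[OF A(1)] image_algebra_hom[OF A(1) cong] inj by (simp add: inj_on_restrict_eq)
  qed
qed

text \<open>
  Each algebra in \<open>S\<close> has an isomorphic copy on one of finitely many sets, fixed in advance, one for
  each size.  These sets exist because the type is infinite.
\<close>

lemma finite_iso_classes:
  fixes V :: "'f presentation" and B S :: "('a, 'f) alg set"
  assumes V: "is_variety V" and inf: "infinite (UNIV :: 'a set)"
    and finite_arity: "finite (arity V ` symbols V)"
    and B: "finite B" "\<And>b. b \<in> B \<Longrightarrow> is_algebra V b \<and> finite (carrier b)"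
    and S: "\<And>A. A \<in> S \<Longrightarrow> is_algebra V A \<and> finite (carrier A) \<and> card (carrier A) \<le> M \<and>
      symbols_identified V B A (Id_on (carrier A))"
  shows "finite (iso_class (finite_algebra_category V) ` S)"
proof -
  have "\<exists>U :: 'a set. finite U \<and> card U = n" for n
    using infinite_arbitrarily_large[OF inf] by blast
  then obtain U :: "nat \<Rightarrow> 'a set" where U: "\<And>n. finite (U n) \<and> card (U n) = n" by metis
  define T where "T n = {A :: ('a, 'f) alg. carrier A = U n \<and> is_algebra V A \<and>
    symbols_identified V B A (Id_on (carrier A))}" for n
  have "finite (\<Union>n \<le> M. T n)"
    using finite_algebras_on[OF finite_arity B] U unfolding T_def by blast
  moreover have "iso_class (finite_algebra_category V) ` S
      \<subseteq> iso_class (finite_algebra_category V) ` (\<Union>n \<le> M. T n)"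
  proof (rule image_subsetI)
    fix A assume "A \<in> S"
    then have A: "is_algebra V A" "finite (carrier A)" "card (carrier A) \<le> M"
      and ident: "symbols_identified V B A (Id_on (carrier A))" using S by blast+
    obtain A' h where A': "is_algebra V A'" "carrier A' = U (card (carrier A))"
      and h: "is_iso (finite_algebra_category V) A A' h"
      using isomorphic_copy[OF V A(1,2), of "U (card (carrier A))"] U by blast
    have hom: "h \<in> surj_homs V A A'" and "inj_on h (carrier A)"
      using h is_iso_iff[OF A(1)] by blast+
    then have "hom_kernel A h = Id_on (carrier A)"
      using hom_kernel_eq_Id_on_iff by blast
    then have "symbols_identified V B A' (Id_on (carrier A'))"
      using symbols_identified_kernel_iff[OF A(1) A'(1) hom] ident by simp
    then have "A' \<in> T (card (carrier A))" using A' by (simp add: T_def)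
    then show "iso_class (finite_algebra_category V) A
        \<in> iso_class (finite_algebra_category V) ` (\<Union>n \<le> M. T n)"
      using iso_class_eqI[OF A(1) A'(1) h] A(3) by blast
  qed
  ultimately show ?thesis by (meson finite_imageI finite_subset)
qed

section \<open>Simple epimorphisms within a level\<close>

text \<open>
  The fibres of a simple epimorphism are the classes of its kernel, which covers the identity relation,
  and an identity class is a point.
\<close>

lemma card_le_of_simple_epi:
  assumes V: "is_variety V" and H: "is_algebra V H" "finite (carrier H)"
    and G: "is_algebra V G" "finite (carrier G)"
    and simple: "is_simple_epi (finite_algebra_category V) H G \<pi>"
    and bound: "cover_index_bounded (carrier H) (congruences V H) N (Id_on (carrier H))"
  shows "card (carrier H) \<le> card (carrier G) * N"
proof -
  have \<pi>: "\<pi> \<in> surj_homs V H G"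
    using simple by (simp add: is_simple_epi_def is_epi_iff)
  have "card {x \<in> carrier H. \<pi> x = y} \<le> N" if "y \<in> carrier G" for y
  proof -
    have "y \<in> \<pi> ` carrier H" using that surj_homsD(2)[OF \<pi>] by simp
    then obtain x where x: "x \<in> carrier H" "\<pi> x = y" by blast
    have "card ((hom_kernel H \<pi> `` {x}) // Id_on (carrier H)) \<le> N"
      using bound simple_epi_covers[OF V H G simple] x(1) unfolding cover_index_bounded_def by blast
    moreover have fibre: "hom_kernel H \<pi> `` {x} = {z \<in> carrier H. \<pi> z = y}"
      using x by (auto simp: hom_kernel_def)
    moreover have "{z \<in> carrier H. \<pi> z = y} // Id_on (carrier H) = (\<lambda>z. {z}) ` {z \<in> carrier H. \<pi> z = y}"
      by (auto simp: quotient_def)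
    ultimately show ?thesis by (simp add: card_image)
  qed
  moreover have "carrier H = (\<Union>y \<in> carrier G. {x \<in> carrier H. \<pi> x = y})"
    using surj_hom_in[OF \<pi>] by blast
  ultimately show ?thesis
    using card_UN_le[OF G(2), of "\<lambda>y. {x \<in> carrier H. \<pi> x = y}"]
      sum_bounded_above[of "carrier G" "\<lambda>y. card {x \<in> carrier H. \<pi> x = y}" N]
    by (metis (no_types, lifting) le_trans of_nat_id)
qed

theorem lemma6p15:
  fixes V :: "'f presentation"
  assumes "malcev_variety V"
    and "finite (arity V ` symbols V)"
    and "infinite (UNIV :: 'a set)"
  shows "diamond_category (finite_algebra_category V :: (('a, 'f) alg, 'a \<Rightarrow> 'a) cat)"
proof -
  let ?C = "finite_algebra_category V :: (('a, 'f) alg, 'a \<Rightarrow> 'a) cat"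
  have V: "is_variety V" using assms(1) by (simp add: malcev_variety_def)
  show ?thesis
  proof (rule diamond_category.intro[OF category_finite_algebra_category diamond_category_axioms.intro])
    fix G :: "('a, 'f) alg" assume "G \<in> Obj ?C"
    then have G: "is_algebra V G" "finite (carrier G)" by simp_all
    show "modular_lattice (quotient_poset ?C G)"
      by (rule modular_lattice_quotients[OF assms(1) G])
    show "finite (carrier (quotient_poset ?C G))"
      by (rule finite_quotients[OF V G])
    have "{f. is_iso ?C G G f} \<subseteq> carrier G \<rightarrow>\<^sub>E carrier G"
      using is_iso_iff[OF G(1)] by (auto simp: PiE_def surj_homs_def)
    then show "finite {f. is_iso ?C G G f}"
      using G(2) by (meson finite_PiE finite_subset)
  next
    fix L and G :: "('a, 'f) alg" assume "is_level ?C L" and "G \<in> L"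
    then obtain B where B: "finite B" "B \<subseteq> Obj ?C" and L: "L = generated_level ?C B"
      unfolding is_level_def by blast
    \<comment> \<open>The element 1 serves the minimal objects, also when \<open>B\<close> is empty.\<close>
    define N where "N = Max (insert 1 ((card \<circ> carrier) ` B))"
    have N: "1 \<le> N" "\<And>b. b \<in> B \<Longrightarrow> card (carrier b) \<le> N"
      using B(1) by (auto simp: N_def)
    have B_alg: "is_algebra V b \<and> finite (carrier b)" if "b \<in> B" for b
      using that B(2) by auto
    note level = generated_level_invariant[OF assms(1) _ N(1), of B]
    have G: "is_algebra V G" "finite (carrier G)"
      using level B_alg N(2) \<open>G \<in> L\<close> unfolding L by blast+
    show "finite (iso_class ?C ` {H \<in> L. \<exists>\<pi>. is_simple_epi ?C H G \<pi>})"
    proof (rule finite_iso_classes[OF V assms(3,2) B(1) B_alg, of _ "card (carrier G) * N"])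
      fix H assume "H \<in> {H \<in> L. \<exists>\<pi>. is_simple_epi ?C H G \<pi>}"
      then obtain \<pi> where "H \<in> L" and simple: "is_simple_epi ?C H G \<pi>" by blast
      then have H: "is_algebra V H" "finite (carrier H)" "level_invariant V B N H (Id_on (carrier H))"
        using level B_alg N(2) unfolding L by blast+
      then show "is_algebra V H \<and> finite (carrier H) \<and> card (carrier H) \<le> card (carrier G) * N \<and>
          symbols_identified V B H (Id_on (carrier H))"
        using card_le_of_simple_epi[OF V H(1,2) G simple] by (simp add: level_invariant_def)
    qed
  next
    have "finite (iso_class ?C ` {G. is_minimal ?C G})"
    \<comment> \<open>All symbols of equal arity agree on the empty set of algebras, as they do in an algebra with one
      element at most.\<close>
    proof (rule finite_iso_classes[OF V assms(3,2), of "{}" _ 1])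
      fix G :: "('a, 'f) alg" assume "G \<in> {G. is_minimal ?C G}"
      then have G: "is_algebra V G" "finite (carrier G)" "card (carrier G) \<le> 1"
        using minimal_card_le_1[OF V] by blast+
      then show "is_algebra V G \<and> finite (carrier G) \<and> card (carrier G) \<le> 1 \<and>
          symbols_identified V {} G (Id_on (carrier G))"
        using symbols_identified_card_le_1[OF G] by blast
    qed simp_all
    then show "countable (iso_class ?C ` {G. is_minimal ?C G})" by (rule countable_finite)
  qed
qed

end
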